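(* Let $\mathcal{F}$ be a minor-closed family of graphs of unbounded bridge-depth. Then for every $b$ there is a graph in $\mathcal{F}$ having an inclusion-wise minimal blocking set of size greater than $b$.
   Context: All graphs are finite, undirected, simple. $\alpha(G)$ is the independence number; $Y\subseteq V(G)$ is a blocking set if $\alpha(G\setminus Y)<\alpha(G)$. Bridge-depth: an edge is a bridge if its removal increases the number of connected components; $\bar G$ is obtained from $G$ by contracting all bridges; ${\sf bd}(G)=0$ for the empty graph, the maximum over components for disconnected $G$, and $1+\min_{v\in V(\bar G)}{\sf bd}(\bar G\setminus v)$ for connected nonempty $G$. Unbounded bridge-depth means for every $c$ some member has bridge-depth $>c$. *)

theory Defs
  imports "Graph_Theory.Graph_Theory"
begin

text \<open>
  Finite simple undirected graphs are the \<^locale>\<open>pair_graph\<close>s: loop-free, finite, with a symmetric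
  arc relation, so that an undirected edge is the pair of arcs \<open>(u, v)\<close>, \<open>(v, u)\<close>.
  On such graphs the strongly connected components \<^const>\<open>pre_digraph.sccs_verts\<close> are the
  connected components.
\<close>

abbreviation components :: "'a pair_pre_digraph \<Rightarrow> 'a set set" where
  "components G \<equiv> pre_digraph.sccs_verts (with_proj G)"

definition induced :: "'a pair_pre_digraph \<Rightarrow> 'a set \<Rightarrow> 'a pair_pre_digraph" where
  "induced G W = \<lparr> pverts = pverts G \<inter> W, parcs = parcs G \<inter> (W \<times> W) \<rparr>"

definition delete_verts :: "'a pair_pre_digraph \<Rightarrow> 'a set \<Rightarrow> 'a pair_pre_digraph" where
  "delete_verts G Y = induced G (pverts G - Y)"

definition delete_edge :: "'a pair_pre_digraph \<Rightarrow> 'a \<times> 'a \<Rightarrow> 'a pair_pre_digraph" where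
  "delete_edge G e = G\<lparr> parcs := parcs G - {e, prod.swap e} \<rparr>"


subsection \<open>Independent sets and blocking sets\<close>

definition independent_set :: "'a pair_pre_digraph \<Rightarrow> 'a set \<Rightarrow> bool" where
  "independent_set G S \<longleftrightarrow> S \<subseteq> pverts G \<and> (\<forall>u\<in>S. \<forall>v\<in>S. (u, v) \<notin> parcs G)"

definition independence_number :: "'a pair_pre_digraph \<Rightarrow> nat" where
  "independence_number G = Max (card ` {S. independent_set G S})"

definition blocking_set :: "'a pair_pre_digraph \<Rightarrow> 'a set \<Rightarrow> bool" where
  "blocking_set G Y \<longleftrightarrow>
     Y \<subseteq> pverts G \<and> independence_number (delete_verts G Y) < independence_number G"

definition minimal_blocking_set :: "'a pair_pre_digraph \<Rightarrow> 'a set \<Rightarrow> bool" where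
  "minimal_blocking_set G Y \<longleftrightarrow> blocking_set G Y \<and> (\<forall>Z. Z \<subset> Y \<longrightarrow> \<not> blocking_set G Z)"


subsection \<open>Minors\<close>

text \<open>
  \<open>\<phi>\<close> assigns to each vertex of \<open>H\<close> its branch set in \<open>G\<close>. Note that the relation is invariant
  under isomorphism in both arguments, so that minor-closed families (over a fixed vertex type)
  are closed under isomorphism.
\<close>

definition minor_model ::
    "'b pair_pre_digraph \<Rightarrow> 'a pair_pre_digraph \<Rightarrow> ('b \<Rightarrow> 'a set) \<Rightarrow> bool" where
  "minor_model H G \<phi> \<longleftrightarrow>
     (\<forall>x\<in>pverts H. \<phi> x \<subseteq> pverts G \<and> connected (induced G (\<phi> x))) \<and>
     (\<forall>x\<in>pverts H. \<forall>y\<in>pverts H. x \<noteq> y \<longrightarrow> \<phi> x \<inter> \<phi> y = {}) \<and>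
     (\<forall>(x, y)\<in>parcs H. \<exists>u\<in>\<phi> x. \<exists>v\<in>\<phi> y. (u, v) \<in> parcs G)"

definition minor :: "'b pair_pre_digraph \<Rightarrow> 'a pair_pre_digraph \<Rightarrow> bool" where
  "minor H G \<longleftrightarrow> (\<exists>\<phi>. minor_model H G \<phi>)"

definition minor_closed :: "'a pair_pre_digraph set \<Rightarrow> bool" where
  "minor_closed F \<longleftrightarrow> (\<forall>G\<in>F. \<forall>H. pair_graph H \<and> minor H G \<longrightarrow> H \<in> F)"


subsection \<open>Contraction of bridges\<close>

definition bridge :: "'a pair_pre_digraph \<Rightarrow> 'a \<times> 'a \<Rightarrow> bool" where
  "bridge G e \<longleftrightarrow> e \<in> parcs G \<and> card (components G) < card (components (delete_edge G e))"

text \<open>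
  To stay within the vertex type, contracting a set \<open>B\<close> of edges keeps one chosen representative
  of each component of the graph with vertices \<^term>\<open>pverts G\<close> and edges \<open>B\<close>. Loops and parallel edges that
  arise are dropped.
\<close>

definition contract_rep :: "'a pair_pre_digraph \<Rightarrow> ('a \<times> 'a) set \<Rightarrow> 'a \<Rightarrow> 'a" where
  "contract_rep G B u =
     (SOME v. v \<in> pre_digraph.scc_of (with_proj \<lparr> pverts = pverts G, parcs = B \<rparr>) u)"

definition contract :: "'a pair_pre_digraph \<Rightarrow> ('a \<times> 'a) set \<Rightarrow> 'a pair_pre_digraph" where
  "contract G B =
     \<lparr> pverts = contract_rep G B ` pverts G,
       parcs = {(contract_rep G B u, contract_rep G B v) | u v.
                  (u, v) \<in> parcs G \<and> contract_rep G B u \<noteq> contract_rep G B v} \<rparr>"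

definition contract_bridges :: "'a pair_pre_digraph \<Rightarrow> 'a pair_pre_digraph" where
  "contract_bridges G = contract G {e. bridge G e}"

lemma pair_graph_induced:
  assumes "pair_graph G"
  shows "pair_graph (induced G W)"
proof -
  interpret pair_graph G by fact
  show ?thesis
    using pair_finite_verts pair_finite_arcs
    by unfold_locales
       (auto simp: induced_def symmetric_def sym_def dest: wellformed' arcs_symmetric no_loops')
qed

lemma pair_graph_contract:
  assumes "pair_graph G"
  shows "pair_graph (contract G B)"
proof -
  interpret pair_graph G by fact
  have "parcs (contract G B) \<subseteq> (\<lambda>(u, v). (contract_rep G B u, contract_rep G B v)) ` parcs G"
    by (auto simp: contract_def)
  then have "finite (parcs (contract G B))"
    using finite_surj[OF pair_finite_arcs] by blast
  moreover have "sym (parcs (contract G B))"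
    unfolding sym_def contract_def by simp (metis arcs_symmetric)
  ultimately show ?thesis
    using pair_finite_verts
    by unfold_locales (auto simp: contract_def symmetric_def dest: wellformed')
qed

text \<open>The choice of the representative depends only on the component.\<close>

lemma contract_rep_eq_iff:
  assumes "sym B" "u \<in> pverts G" "v \<in> pverts G"
  shows "contract_rep G B u = contract_rep G B v
    \<longleftrightarrow> u \<rightarrow>\<^sup>*\<^bsub>with_proj \<lparr> pverts = pverts G, parcs = B \<rparr>\<^esub> v"
proof -
  let ?H = "with_proj \<lparr> pverts = pverts G, parcs = B \<rparr>"
  have trans: "x \<rightarrow>\<^sup>*\<^bsub>?H\<^esub> y \<Longrightarrow> y \<rightarrow>\<^sup>*\<^bsub>?H\<^esub> z \<Longrightarrow> x \<rightarrow>\<^sup>*\<^bsub>?H\<^esub> z" for x y z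
    unfolding reachable_def by (rule rtrancl_on_trans)
  have symr: "x \<rightarrow>\<^sup>*\<^bsub>?H\<^esub> y \<Longrightarrow> y \<rightarrow>\<^sup>*\<^bsub>?H\<^esub> x" for x y
    using rtrancl_on_sym[OF assms(1), of "pverts G"] unfolding reachable_def
    by (auto elim: symE)
  have scc: "pre_digraph.scc_of ?H x = {y. x \<rightarrow>\<^sup>*\<^bsub>?H\<^esub> y}" for x
    using symr by (auto simp: pre_digraph.scc_of_def)
  have rep: "x \<rightarrow>\<^sup>*\<^bsub>?H\<^esub> contract_rep G B x" if "x \<in> pverts G" for x
  proof -
    have "x \<rightarrow>\<^sup>*\<^bsub>?H\<^esub> x" using that by (simp add: reachable_def)
    then show ?thesis unfolding contract_rep_def scc mem_Collect_eq by (rule someI)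
  qed
  show ?thesis
  proof
    assume "contract_rep G B u = contract_rep G B v"
    with rep[OF assms(2)] rep[OF assms(3)] show "u \<rightarrow>\<^sup>*\<^bsub>?H\<^esub> v"
      by (metis symr trans)
  next
    assume "u \<rightarrow>\<^sup>*\<^bsub>?H\<^esub> v"
    then have "{y. u \<rightarrow>\<^sup>*\<^bsub>?H\<^esub> y} = {y. v \<rightarrow>\<^sup>*\<^bsub>?H\<^esub> y}"
      using symr trans by blast
    then show "contract_rep G B u = contract_rep G B v"
      by (simp add: contract_rep_def scc)
  qed
qed


subsection \<open>Bridge-depth\<close>

lemma component_psubset:
  assumes "C \<in> components G" "\<not> connected G"
  shows "C \<subset> pverts G"
proof -
  have C: "C \<noteq> {}" "\<And>u v. u \<in> C \<Longrightarrow> v \<in> C \<Longrightarrow> (u, v) \<in> rtrancl_on (pverts G) (parcs G)"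
    using assms(1) by (auto simp: pre_digraph.sccs_verts_def reachable_def)
  then have "C \<subseteq> pverts G" by (blast dest: in_rtrancl_on_in_F)
  moreover have "C \<noteq> pverts G"
  proof
    assume "C = pverts G"
    moreover have "parcs G \<subseteq> parcs (mk_symmetric G)"
      by (force simp: parcs_mk_symmetric)
    ultimately have "connected G"
      using C unfolding connected_def strongly_connected_def reachable_def
      by (auto intro: rtrancl_on_mono)
    with assms(2) show False by blast
  qed
  ultimately show ?thesis by blast
qed

text \<open>Infinite graphs are assigned the dummy value 0.\<close>

function bridge_depth :: "'a pair_pre_digraph \<Rightarrow> nat" where
  "bridge_depth G =
     (if infinite (pverts G) \<or> pverts G = {} then 0
      else if connected G then
        1 + Min ((\<lambda>v. bridge_depth (delete_verts (contract_bridges G) {v}))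
                   ` pverts (contract_bridges G))
      else Max ((\<lambda>C. bridge_depth (induced G C)) ` components G))"
  by pat_completeness auto
termination
proof (relation "measure (\<lambda>G. card (pverts G))", goal_cases)
  case 1
  show ?case by simp
next
  case (2 G v)
  let ?H = "contract_bridges G"
  have "finite (pverts ?H)" "card (pverts ?H) \<le> card (pverts G)"
    using 2 by (auto simp: contract_bridges_def contract_def intro: card_image_le)
  moreover have "pverts (delete_verts ?H {v}) = pverts ?H - {v}"
    by (auto simp: delete_verts_def induced_def)
  ultimately show ?case
    using 2(3) card_Diff1_less[of "pverts ?H" v] by simp
next
  case (3 G C)
  then have "C \<subset> pverts G" by (simp add: component_psubset)
  then have "pverts G \<inter> C \<subset> pverts G" by blast
  with 3 show ?case by (auto simp: induced_def intro: psubset_card_mono)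
qed

declare bridge_depth.simps [simp del]

definition unbounded_bridge_depth :: "'a pair_pre_digraph set \<Rightarrow> bool" where
  "unbounded_bridge_depth F \<longleftrightarrow> (\<forall>c. \<exists>G\<in>F. bridge_depth G > c)"

end

theory Submission
  imports Defs "HOL-Library.Ramsey"
begin

text \<open>
  Call a sequence of disjoint connected vertex sets in which consecutive sets are joined by at least
  two edges a necklace. Graphs without a necklace of \<open>n + 1\<close> pieces have bounded bridge-depth, by
  induction on \<open>n\<close>. In a connected bridgeless graph two disjoint necklaces of \<open>n\<close> pieces could be
  joined, through their longer halves, to a necklace of \<open>n + 1\<close> pieces; hence after contracting the
  bridges of a component, any two necklaces of \<open>n\<close> pieces intersect. A pairwise intersecting family of
  connected sets has a hitting set of bounded size unless the graph contains a long ladder, by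
  Menger's theorem and Ramsey's theorem, and a ladder contains a long necklace. Deleting the hitting
  set vertex by vertex, contracting bridges in between, destroys all necklaces of \<open>n\<close> pieces.

  A necklace of \<open>2 t\<close> pieces contains as a minor a path of \<open>t\<close> triangles, consecutive ones joined by
  an edge. Its apexes and its two end vertices together form a minimal blocking set.
\<close>

subsection \<open>Connected vertex sets\<close>

text \<open>Double links fit bridge-depth because a bridge is what they rule out. Once all bridges
  of a connected graph are contracted, every cut has at least two edges, and a necklace of the
  contracted graph pulls back to one of the original graph, so contraction creates no necklaces. The
  same pull-back carries hitting sets over to the contracted graph, which is what allows a hitting
  set to be deleted one vertex at a time although the graph changes after every deletion. The
  delicate count is in the joining step. The longer parts of two necklaces may have only (n + 1) / 2
  pieces each, and joining them along a single edge costs a piece, so one edge between the necklaces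
  may not be enough when n is odd; a second edge repairs this. Connected vertex sets replace paths
  wherever possible, and they are cut down to single end vertices only where positions along a path
  matter. A triangle consumes two pieces, since it arises from the two edges between adjacent
  pieces; the next double link supplies the edge to the following triangle.\<close>

definition conn :: "('a \<times> 'a) set \<Rightarrow> 'a set \<Rightarrow> bool" where
  "conn E S \<longleftrightarrow> S \<noteq> {} \<and> (\<forall>u\<in>S. \<forall>v\<in>S. (u, v) \<in> rtrancl_on S E)"

lemma conn_nonempty: "conn E S \<Longrightarrow> S \<noteq> {}"
  by (simp add: conn_def)

lemma conn_singleton [simp]: "conn E {x}"
  by (simp add: conn_def)

lemma conn_mono: "conn E S \<Longrightarrow> E \<subseteq> E' \<Longrightarrow> conn E' S"
  unfolding conn_def by (meson rtrancl_on_mono order_refl)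

lemma conn_cong: "(\<And>u v. u \<in> S \<Longrightarrow> v \<in> S \<Longrightarrow> (u, v) \<in> E \<Longrightarrow> (u, v) \<in> E') \<Longrightarrow> conn E S \<Longrightarrow> conn E' S"
proof -
  assume *: "\<And>u v. u \<in> S \<Longrightarrow> v \<in> S \<Longrightarrow> (u, v) \<in> E \<Longrightarrow> (u, v) \<in> E'" and c: "conn E S"
  have "(u, v) \<in> rtrancl_on S E'" if "(u, v) \<in> rtrancl_on S E" for u v
    using that
    by (induction rule: rtrancl_on_induct) (auto intro: rtrancl_on_into_rtrancl_on * dest: in_rtrancl_on_in_F)
  with c show ?thesis by (auto simp: conn_def)
qed

text \<open>A walk from inside \<open>A\<close> to outside it crosses at some arc. Connectivity is
  mostly used in this form: a part smaller than the connected set around it has an outgoing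
  arc.\<close>

lemma conn_cut:
  assumes "conn E S" "A \<subseteq> S" "A \<noteq> {}" "A \<noteq> S"
  shows "\<exists>a\<in>A. \<exists>b\<in>S - A. (a, b) \<in> E"
proof (rule ccontr)
  assume *: "\<not> ?thesis"
  obtain a b where ab: "a \<in> A" "b \<in> S - A" using assms by blast
  have "(a, b) \<in> rtrancl_on S E" using assms(1,2) ab by (auto simp: conn_def)
  then have "b \<in> A"
    by (induction rule: rtrancl_on_induct) (use * ab in auto)
  with ab show False by simp
qed

lemma connI_root:
  assumes "sym E" "r \<in> S" "\<And>v. v \<in> S \<Longrightarrow> (r, v) \<in> rtrancl_on S E"
  shows "conn E S"
proof -
  have "(u, v) \<in> rtrancl_on S E" if "u \<in> S" "v \<in> S" for u v
    using symD[OF rtrancl_on_sym[OF assms(1)] assms(3)[OF that(1)]] assms(3)[OF that(2)]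
    by (rule rtrancl_on_trans)
  with assms(2) show ?thesis by (auto simp: conn_def)
qed

lemma conn_Un:
  assumes "sym E" "conn E A" "conn E B" "A \<inter> B \<noteq> {} \<or> (\<exists>a\<in>A. \<exists>b\<in>B. (a, b) \<in> E)"
  shows "conn E (A \<union> B)"
proof -
  have "\<exists>a b. a \<in> A \<and> b \<in> B \<and> (a, b) \<in> rtrancl_on (A \<union> B) E"
    using assms(4)
  proof
    assume "\<exists>a\<in>A. \<exists>b\<in>B. (a, b) \<in> E"
    then obtain a b where ab: "a \<in> A" "b \<in> B" "(a, b) \<in> E" by blast
    then have "(a, b) \<in> rtrancl_on (A \<union> B) E"
      using rtrancl_on_into_rtrancl_on[OF rtrancl_on_refl[of a "A \<union> B"] ab(3)] by simp
    with ab show ?thesis by blast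
  next
    assume "A \<inter> B \<noteq> {}"
    then obtain a where "a \<in> A" "a \<in> B" by blast
    then show ?thesis by (intro exI[of _ a]) simp
  qed
  then obtain a b where ab: "a \<in> A" "b \<in> B" "(a, b) \<in> rtrancl_on (A \<union> B) E" by blast
  have A: "(a, v) \<in> rtrancl_on (A \<union> B) E" if "v \<in> A" for v
    using assms(2) ab that by (intro rtrancl_on_mono[OF order_refl Un_upper1]) (simp add: conn_def)
  have B: "(b, v) \<in> rtrancl_on (A \<union> B) E" if "v \<in> B" for v
    using assms(3) ab that by (intro rtrancl_on_mono[OF order_refl Un_upper2]) (simp add: conn_def)
  show ?thesis
  proof (rule connI_root[OF assms(1), of a])
    show "a \<in> A \<union> B" using ab by simp
    show "(a, v) \<in> rtrancl_on (A \<union> B) E" if "v \<in> A \<union> B" for v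
      using that A rtrancl_on_trans[OF ab(3) B] by blast
  qed
qed

lemma conn_insert:
  assumes "sym E" "conn E A" "a \<in> A" "(a, x) \<in> E"
  shows "conn E (insert x A)"
  using conn_Un[OF assms(1,2), of "{x}"] assms(3,4) by auto

definition component :: "('a \<times> 'a) set \<Rightarrow> 'a set \<Rightarrow> 'a \<Rightarrow> 'a set" where
  "component E D b = {w. (b, w) \<in> rtrancl_on D E}"

lemma component_subset: "component E D b \<subseteq> D"
  by (auto simp: component_def dest: in_rtrancl_on_in_F)

lemma in_component_self: "b \<in> D \<Longrightarrow> b \<in> component E D b"
  by (simp add: component_def)

lemma component_closed: "a \<in> component E D b \<Longrightarrow> (a, w) \<in> E \<Longrightarrow> w \<in> D \<Longrightarrow> w \<in> component E D b"
  by (auto simp: component_def intro: rtrancl_on_into_rtrancl_on)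

lemma conn_component:
  assumes "sym E" "b \<in> D" shows "conn E (component E D b)"
proof -
  have "(b, v) \<in> rtrancl_on (component E D b) E" if "(b, v) \<in> rtrancl_on D E" for v
    using that
  proof (induction rule: rtrancl_on_induct)
    case base then show ?case by (simp add: component_def)
  next
    case (step y z)
    then have "z \<in> component E D b" by (auto simp: component_def intro: rtrancl_on_into_rtrancl_on)
    with step show ?case using rtrancl_on_into_rtrancl_on by metis
  qed
  then show ?thesis
    using assms by (intro connI_root[of E b]) (auto simp: component_def)
qed

lemma conn_subset_component:
  assumes "conn E B" "B \<subseteq> D" "B \<inter> component E D b \<noteq> {}"
  shows "B \<subseteq> component E D b"
proof
  fix v assume v: "v \<in> B"
  obtain w where w: "w \<in> B" "w \<in> component E D b" using assms(3) by blast
  have "(w, v) \<in> rtrancl_on D E"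
    using assms(1) v w by (intro rtrancl_on_mono[OF order_refl assms(2)]) (simp add: conn_def)
  with w show "v \<in> component E D b" unfolding component_def using rtrancl_on_trans by fast
qed

text \<open>As long as \<open>S\<close> is not covered, some arc leads from a part to an uncovered
  vertex, and that part absorbs the vertex. This serves to split a set between two vertices and to
  make two necklaces fill the whole graph.\<close>

lemma conn_grow:
  assumes E: "sym E" and S: "finite S" "conn E S" and I: "I \<noteq> {}"
    and P: "\<And>i. i \<in> I \<Longrightarrow> conn E (P i)" "\<And>i. i \<in> I \<Longrightarrow> P i \<subseteq> S"
    and disj: "\<And>i j. i \<in> I \<Longrightarrow> j \<in> I \<Longrightarrow> i \<noteq> j \<Longrightarrow> P i \<inter> P j = {}"
  shows "\<exists>Q. (\<forall>i\<in>I. P i \<subseteq> Q i \<and> conn E (Q i)) \<and> (\<forall>i\<in>I. \<forall>j\<in>I. i \<noteq> j \<longrightarrow> Q i \<inter> Q j = {}) \<and>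
    (\<Union>i\<in>I. Q i) = S"
  using P disj
proof (induction "card (S - (\<Union>i\<in>I. P i))" arbitrary: P rule: less_induct)
  case less
  show ?case
  proof (cases "(\<Union>i\<in>I. P i) = S")
    case True
    then show ?thesis using less.prems by blast
  next
    case False
    have "(\<Union>i\<in>I. P i) \<subseteq> S" using less.prems by blast
    moreover have "(\<Union>i\<in>I. P i) \<noteq> {}"
      using less.prems(1) I by (auto simp: conn_def)
    ultimately obtain a b where ab: "a \<in> (\<Union>i\<in>I. P i)" "b \<in> S - (\<Union>i\<in>I. P i)" "(a, b) \<in> E"
      using conn_cut[OF S(2), of "\<Union>i\<in>I. P i"] False by blast
    then obtain i where i: "i \<in> I" "a \<in> P i" by blast
    define P' where "P' = P(i := insert b (P i))"
    have P'U: "(\<Union>i\<in>I. P' i) = insert b (\<Union>i\<in>I. P i)"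
      using i by (auto simp: P'_def split: if_splits)
    have "\<exists>Q. (\<forall>i\<in>I. P' i \<subseteq> Q i \<and> conn E (Q i)) \<and> (\<forall>i\<in>I. \<forall>j\<in>I. i \<noteq> j \<longrightarrow> Q i \<inter> Q j = {}) \<and>
      (\<Union>i\<in>I. Q i) = S"
    proof (rule less.hyps)
      show "card (S - (\<Union>i\<in>I. P' i)) < card (S - (\<Union>i\<in>I. P i))"
        unfolding P'U by (rule psubset_card_mono) (use S ab in auto)
      show "conn E (P' j)" if "j \<in> I" for j
        using that i ab less.prems(1) by (auto simp: P'_def intro: conn_insert[OF E])
      show "P' j \<subseteq> S" if "j \<in> I" for j
        using that ab i less.prems(2) by (auto simp: P'_def)
      show "P' j \<inter> P' k = {}" if "j \<in> I" "k \<in> I" "j \<noteq> k" for j k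
      proof -
        have "b \<notin> P j" "b \<notin> P k" using ab that by auto
        with less.prems(3)[OF that] that(3) show ?thesis by (auto simp: P'_def)
      qed
    qed
    then obtain Q where Q: "\<forall>i\<in>I. P' i \<subseteq> Q i \<and> conn E (Q i)"
        "\<forall>i\<in>I. \<forall>j\<in>I. i \<noteq> j \<longrightarrow> Q i \<inter> Q j = {}" "(\<Union>i\<in>I. Q i) = S" by blast
    moreover have "P j \<subseteq> P' j" for j by (auto simp: P'_def)
    ultimately show ?thesis by (intro exI[of _ Q]) blast
  qed
qed

lemma conn_split:
  assumes "sym E" "finite S" "conn E S" "a \<in> S" "b \<in> S" "a \<noteq> b"
  shows "\<exists>A B. a \<in> A \<and> b \<in> B \<and> conn E A \<and> conn E B \<and> A \<inter> B = {} \<and> A \<union> B = S"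
proof -
  define P where "P i = (if i then {a} else {b})" for i
  have "\<exists>Q. (\<forall>i\<in>UNIV. P i \<subseteq> Q i \<and> conn E (Q i)) \<and>
      (\<forall>i\<in>UNIV. \<forall>j\<in>UNIV. i \<noteq> j \<longrightarrow> Q i \<inter> Q j = {}) \<and> (\<Union>i\<in>UNIV. Q i) = S"
    by (rule conn_grow[OF assms(1-3)]) (use assms(4-) in \<open>auto simp: P_def\<close>)
  then obtain Q where Q: "\<And>i. P i \<subseteq> Q i" "\<And>i. conn E (Q i)"
      "\<And>i j. i \<noteq> j \<Longrightarrow> Q i \<inter> Q j = {}" "(\<Union>i. Q i) = S" by (metis UNIV_I)
  have "a \<in> Q True" "b \<in> Q False" using Q(1)[of True] Q(1)[of False] by (auto simp: P_def)
  moreover have "Q True \<union> Q False = S" using Q(4) by (simp add: UNIV_bool Un_commute)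
  ultimately show ?thesis using Q(2) Q(3)[of True False] by blast
qed


subsection \<open>Menger's theorem for disjoint connected sets\<close>

text \<open>Connected sets stand in for the paths of Menger's theorem: components and unions of
  meeting sets are connected again without surgery on walks, and \<open>links_single\<close>
  recovers single end vertices.\<close>

definition links :: "('a \<times> 'a) set \<Rightarrow> 'a set \<Rightarrow> 'a set \<Rightarrow> 'a set \<Rightarrow> bool" where
  "links E A B C \<longleftrightarrow> conn E C \<and> C \<inter> A \<noteq> {} \<and> C \<inter> B \<noteq> {}"

definition separates :: "('a \<times> 'a) set \<Rightarrow> 'a set \<Rightarrow> 'a set \<Rightarrow> 'a set \<Rightarrow> bool" where
  "separates E A B X \<longleftrightarrow> (\<forall>C. links E A B C \<longrightarrow> C \<inter> X \<noteq> {})"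

lemma links_commute: "links E A B C \<longleftrightarrow> links E B A C"
  by (auto simp: links_def)

lemma separates_commute: "separates E A B X \<longleftrightarrow> separates E B A X"
  by (simp add: separates_def links_commute)

text \<open>Walk inside \<open>C\<close> from \<open>A\<close> and stop on first reaching
  \<open>s\<close>: the component of \<open>C - {s}\<close> around a vertex of \<open>A\<close>
  borders on \<open>s\<close> and avoids \<open>X\<close>. Apart from \<open>s\<close> the result
  lies on the \<open>A\<close>-side of \<open>X\<close>, which keeps sets trimmed on the two sides
  of a separator apart.\<close>

lemma conn_trim:
  assumes E: "sym E" and C: "conn E C" "C \<inter> A \<noteq> {}" "s \<in> C" "C \<inter> X \<subseteq> {s}"
  shows "\<exists>C'. C' \<subseteq> C \<and> conn E C' \<and> s \<in> C' \<and> C' \<inter> A \<noteq> {} \<and>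
    C' - {s} \<subseteq> \<Union>{W. conn E W \<and> W \<inter> A \<noteq> {} \<and> W \<inter> X = {}}"
proof -
  obtain a where a: "a \<in> C" "a \<in> A" using C by blast
  show ?thesis
  proof (cases "a = s")
    case True
    then show ?thesis using a by (intro exI[of _ "{s}"]) auto
  next
    case False
    define W where "W = component E (C - {s}) a"
    have W: "conn E W" "a \<in> W" "W \<subseteq> C - {s}"
      using a False by (auto simp: W_def intro!: conn_component[OF E] in_component_self dest: component_subset[THEN subsetD])
    obtain w b where wb: "w \<in> W" "b \<in> C - W" "(w, b) \<in> E"
      using conn_cut[OF C(1), of W] W C(3) by blast
    have "b = s"
      using wb component_closed[of w E "C - {s}" a b] by (auto simp: W_def)
    then have "conn E (insert s W)" using wb by (auto intro: conn_insert[OF E W(1)])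
    moreover have "W \<inter> A \<noteq> {}" "W \<inter> X = {}" using W a C(4) by auto
    ultimately show ?thesis using W C(3) by (intro exI[of _ "insert s W"]) auto
  qed
qed

lemma conn_delete_edge:
  assumes "conn E C" "\<not> (x \<in> C \<and> y \<in> C)"
  shows "conn (E - {(x, y), (y, x)}) C"
  by (rule conn_cong[OF _ assms(1)]) (use assms(2) in auto)

text \<open>
  The induction step of Goering's proof: \<open>X\<close> separates \<open>A\<close> from \<open>B\<close> after the edge \<open>x y\<close> has been
  deleted, and \<open>x\<close> lies on the \<open>A\<close>-side; this is witnessed by \<open>Ca\<close>.
\<close>

lemma separates_lift:
  assumes E: "sym E" and E'_def: "E' = E - {(x, y), (y, x)}"
    and X: "separates E' A B X"
    and Cb: "conn E' Cb" "y \<in> Cb" "Cb \<inter> B \<noteq> {}" "Cb \<inter> X = {}"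
    and sep: "separates E A B (insert x X)"
    and Z: "separates E' A (insert x X) Z"
  shows "separates E A B Z"
  unfolding separates_def
proof (intro allI impI)
  fix C assume C: "links E A B C"
  have E': "sym E'" using E by (auto simp: E'_def sym_def)
  obtain a where a: "a \<in> C" "a \<in> A" using C by (auto simp: links_def)
  define D where "D = component E' C a"
  have D: "conn E' D" "a \<in> D" "D \<subseteq> C"
    using a component_subset[of E' C a] by (auto simp: D_def intro: conn_component[OF E'] in_component_self)
  \<comment> \<open>If deleting the edge cuts \<open>C\<close>, the piece \<open>D\<close> around
    \<open>a\<close> contains one of its ends. Should that be \<open>y\<close>, then
    \<open>D\<close> continues through \<open>Cb\<close> to \<open>B\<close>, so \<open>X\<close>
    already meets \<open>D\<close>.\<close>
  have "D \<inter> insert x X \<noteq> {}"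
  proof (cases "D = C")
    case True
    then show ?thesis using sep C by (auto simp: separates_def)
  next
    case False
    then obtain u v where uv: "u \<in> D" "v \<in> C - D" "(u, v) \<in> E"
      using conn_cut[of E C D] C D by (auto simp: links_def)
    then have "(u, v) \<notin> E'" using component_closed[of u E' C a v] by (auto simp: D_def)
    then have "x \<in> D \<or> y \<in> D" using uv by (auto simp: E'_def)
    then show ?thesis
    proof
      assume y: "y \<in> D"
      have "links E' A B (D \<union> Cb)"
        unfolding links_def using conn_Un[OF E' D(1) Cb(1)] y Cb D a by blast
      then have "(D \<union> Cb) \<inter> X \<noteq> {}" using X by (auto simp: separates_def)
      with Cb(4) show ?thesis by blast
    qed auto
  qed
  then have "links E' A (insert x X) D" using D a by (auto simp: links_def)
  then show "C \<inter> Z \<noteq> {}" using Z D by (auto simp: separates_def)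
qed

text \<open>Pigeonhole: disjoint members contain different elements of \<open>T\<close>, and there
  are as many members as elements, so members and elements correspond one to one.\<close>

lemma disjoint_transversal:
  assumes "finite T" "card \<P> = card T" "finite \<P>"
    and "pairwise disjnt \<P>" "\<And>P. P \<in> \<P> \<Longrightarrow> P \<inter> T \<noteq> {}"
  shows "\<exists>p. (\<forall>s\<in>T. p s \<in> \<P> \<and> p s \<inter> T = {s})"
proof -
  have "\<forall>P\<in>\<P>. \<exists>s. s \<in> P \<inter> T" using assms(5) by blast
  then obtain g where g: "\<And>P. P \<in> \<P> \<Longrightarrow> g P \<in> P \<inter> T" by metis
  have inj: "inj_on g \<P>"
  proof (rule inj_onI)
    fix P P' assume P: "P \<in> \<P>" "P' \<in> \<P>" "g P = g P'"
    then have "g P \<in> P \<inter> P'" using g[of P] g[of P'] by auto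
    with P assms(4) show "P = P'" by (auto simp: pairwise_def disjnt_def)
  qed
  have im: "g ` \<P> = T"
    using g inj assms by (intro card_subset_eq) (auto simp: card_image)
  have "\<exists>P\<in>\<P>. P \<inter> T = {s}" if s: "s \<in> T" for s
  proof -
    obtain P where P: "P \<in> \<P>" "g P = s" using im s by blast
    have "s' = s" if s': "s' \<in> P \<inter> T" for s'
    proof -
      obtain P' where P': "P' \<in> \<P>" "g P' = s'" using im s' by blast
      then have "s' \<in> P'" using g by blast
      then have "P' = P" using assms(4) P P' s' by (auto simp: pairwise_def disjnt_def)
      with P P' show ?thesis by simp
    qed
    with P g show ?thesis by blast
  qed
  then show ?thesis by metis
qed

text \<open>Induction on the number of arcs. If deleting an edge \<open>x y\<close> admits a
  separator \<open>X\<close> with fewer than \<open>m\<close> vertices, then \<open>X\<close> with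
  \<open>x\<close> and \<open>X\<close> with \<open>y\<close> both separate before the deletion and
  hence have exactly \<open>m\<close> vertices. The induction hypothesis links \<open>A\<close> to
  the first and the second to \<open>B\<close>; the two families are glued at the vertices of
  \<open>X\<close> and along the edge \<open>x y\<close>.\<close>

theorem menger_conn:
  fixes E :: "('a \<times> 'a) set"
  assumes "sym E" "finite E" "finite A" "finite B"
    and "\<And>X. finite X \<Longrightarrow> separates E A B X \<Longrightarrow> m \<le> card X"
  shows "\<exists>\<C>. finite \<C> \<and> card \<C> = m \<and> pairwise disjnt \<C> \<and> (\<forall>C\<in>\<C>. links E A B C)"
  using assms
proof (induction "card E" arbitrary: E A B rule: less_induct)
  case less
  note E = \<open>sym E\<close>
  show ?case
  proof (cases "E = {}")
    case True
    \<comment> \<open>Without arcs a connected set is a single vertex.\<close>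
    have "separates E A B (A \<inter> B)"
      unfolding separates_def
    proof (intro allI impI)
      fix C assume C: "links E A B C"
      obtain a b where ab: "a \<in> C" "a \<in> A" "b \<in> C" "b \<in> B" using C by (auto simp: links_def)
      then have "(a, b) \<in> rtrancl_on C E" using C by (auto simp: links_def conn_def)
      then have "a = b" by (induction rule: rtrancl_on_induct) (use True in auto)
      with ab show "C \<inter> (A \<inter> B) \<noteq> {}" by blast
    qed
    then have "m \<le> card (A \<inter> B)" using less.prems by auto
    then obtain T where T: "T \<subseteq> A \<inter> B" "card T = m" "finite T"
      by (meson obtain_subset_with_card_n less.prems(3) finite_Int finite_subset)
    show ?thesis
      by (rule exI[of _ "(\<lambda>x. {x}) ` T"]) (use T in \<open>auto simp: card_image pairwise_def links_def\<close>)
  next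
    case False
    then obtain x y where xy: "(x, y) \<in> E" by auto
    define E' where "E' = E - {(x, y), (y, x)}"
    have E': "sym E'" using E by (auto simp: E'_def sym_def)
    have sub: "E' \<subseteq> E" and fin: "finite E'" using less.prems(2) by (auto simp: E'_def)
    have card: "card E' < card E"
      by (rule psubset_card_mono) (use less.prems(2) xy in \<open>auto simp: E'_def\<close>)
    show ?thesis
    proof (cases "\<forall>X. finite X \<longrightarrow> separates E' A B X \<longrightarrow> m \<le> card X")
      case True
      then obtain \<C> where "finite \<C>" "card \<C> = m" "pairwise disjnt \<C>" "\<forall>C\<in>\<C>. links E' A B C"
        using less.hyps[OF card E' fin less.prems(3,4)] by blast
      then show ?thesis using conn_mono[OF _ sub] by (auto simp: links_def)
    next
      case False
      then obtain X where X: "finite X" "separates E' A B X" "card X < m" by auto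
      have "\<not> separates E A B X" using less.prems(5)[OF X(1)] X(3) by auto
      then obtain C where C: "links E A B C" "C \<inter> X = {}" by (auto simp: separates_def)
      obtain a b where ab: "a \<in> C" "a \<in> A" "b \<in> C" "b \<in> B" using C by (auto simp: links_def)
      \<comment> \<open>As \<open>C\<close> avoids \<open>X\<close>, the deletion must disconnect
        \<open>a\<close> from \<open>b\<close> inside it; the pieces around them contain one end of
        the deleted edge each.\<close>
      define Ca where "Ca = component E' C a"
      define Cb where "Cb = component E' C b"
      have Ca: "conn E' Ca" "a \<in> Ca" "Ca \<subseteq> C"
        using ab component_subset[of E' C a] by (auto simp: Ca_def intro: conn_component[OF E'] in_component_self)
      have Cb: "conn E' Cb" "b \<in> Cb" "Cb \<subseteq> C"
        using ab component_subset[of E' C b] by (auto simp: Cb_def intro: conn_component[OF E'] in_component_self)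
      have dis: "Ca \<inter> Cb = {}"
      proof (rule ccontr)
        assume "Ca \<inter> Cb \<noteq> {}"
        then have "links E' A B (Ca \<union> Cb)"
          unfolding links_def using conn_Un[OF E' Ca(1) Cb(1)] Ca Cb ab by blast
        then show False using X(2) C(2) Ca Cb by (auto simp: separates_def)
      qed
      have out: "x \<in> D \<or> y \<in> D"
        if D: "D \<noteq> C" "D \<noteq> {}" "D \<subseteq> C" "\<And>u v. u \<in> D \<Longrightarrow> (u, v) \<in> E' \<Longrightarrow> v \<in> C \<Longrightarrow> v \<in> D" for D
      proof -
        obtain u v where uv: "u \<in> D" "v \<in> C - D" "(u, v) \<in> E"
          using conn_cut[OF _ D(3,2,1), of E] C by (auto simp: links_def)
        then have "(u, v) \<notin> E'" using D(4) by auto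
        with uv show ?thesis by (auto simp: E'_def)
      qed
      have oa: "x \<in> Ca \<or> y \<in> Ca"
        using out[of Ca] Ca Cb dis component_closed[of _ E' C a] by (auto simp: Ca_def)
      have ob: "x \<in> Cb \<or> y \<in> Cb"
        using out[of Cb] Ca Cb dis component_closed[of _ E' C b] by (auto simp: Cb_def)
      \<comment> \<open>The names \<open>x\<close> and \<open>y\<close> are bound afresh, because it
        is not known in advance which end of the edge lies in \<open>Ca\<close>.\<close>
      have main: ?thesis if xy: "(x, y) \<in> E" and E'_def: "E' = E - {(x, y), (y, x)}"
        and x: "x \<in> Ca" and y: "y \<in> Cb" for x y
      proof -
        have sep_insert: "separates E A B (insert z X)" if z: "z = x \<or> z = y" for z
          unfolding separates_def
        proof (intro allI impI notI)
          fix K assume K: "links E A B K" "K \<inter> insert z X = {}"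
          then have "conn E' K"
            unfolding E'_def using z by (intro conn_delete_edge) (auto simp: links_def)
          then show False using X(2) K by (auto simp: links_def separates_def)
        qed
        have nX: "x \<notin> X" "y \<notin> X" using x y Ca Cb C(2) by auto
        have xney: "x \<noteq> y" using x y dis by auto
        have cardX: "card (insert x X) = m" "card (insert y X) = m"
          using less.prems(5)[OF _ sep_insert[of x]] X nX by auto
        have "m \<le> card Z" if "finite Z" "separates E' A (insert x X) Z" for Z
          by (rule less.prems(5)[OF that(1)],
              rule separates_lift[OF E E'_def X(2) Cb(1) y _ _ sep_insert that(2)])
            (use Cb ab C(2) in auto)
        then obtain \<P> where P: "finite \<P>" "card \<P> = m" "pairwise disjnt \<P>"
            "\<And>P. P \<in> \<P> \<Longrightarrow> links E' A (insert x X) P"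
          using less.hyps[OF card E' fin less.prems(3), of "insert x X"] X(1) by auto
        have E'_def': "E' = E - {(y, x), (x, y)}" using E'_def by auto
        have "m \<le> card Z" if "finite Z" "separates E' (insert y X) B Z" for Z
          by (rule less.prems(5)[OF that(1)], subst separates_commute,
              rule separates_lift[OF E E'_def' _ Ca(1) x _ _ _ that(2)[unfolded separates_commute[of _ "insert y X"]]])
            (use Ca ab C(2) X(2) sep_insert in \<open>auto simp: separates_commute[of _ B A]\<close>)
        then obtain \<Q> where Q: "finite \<Q>" "card \<Q> = m" "pairwise disjnt \<Q>"
            "\<And>P. P \<in> \<Q> \<Longrightarrow> links E' (insert y X) B P"
          using less.hyps[OF card E' fin _ less.prems(4), of "insert y X"] X(1) by auto
        obtain p where p: "\<And>s. s \<in> insert x X \<Longrightarrow> p s \<in> \<P> \<and> p s \<inter> insert x X = {s}"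
          using disjoint_transversal[of "insert x X" \<P>] P X(1) cardX unfolding links_def
          by (metis finite_insert)
        obtain q where q: "\<And>s. s \<in> insert y X \<Longrightarrow> q s \<in> \<Q> \<and> q s \<inter> insert y X = {s}"
          using disjoint_transversal[of "insert y X" \<Q>] Q X(1) cardX unfolding links_def
          by (metis finite_insert)
        \<comment> \<open>\<open>RA\<close> and \<open>RB\<close> are what \<open>A\<close> and
          \<open>B\<close> reach in \<open>E'\<close> without meeting \<open>X\<close>; a common
          vertex would yield a linking set that \<open>X\<close> misses.\<close>
        define RA where "RA = \<Union>{W. conn E' W \<and> W \<inter> A \<noteq> {} \<and> W \<inter> X = {}}"
        define RB where "RB = \<Union>{W. conn E' W \<and> W \<inter> B \<noteq> {} \<and> W \<inter> X = {}}"
        have RAB: "RA \<inter> RB = {}"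
        proof (rule ccontr)
          assume "RA \<inter> RB \<noteq> {}"
          then obtain w W W' where "w \<in> W \<inter> W'" "conn E' W" "W \<inter> A \<noteq> {}" "W \<inter> X = {}"
              "conn E' W'" "W' \<inter> B \<noteq> {}" "W' \<inter> X = {}"
            by (auto simp: RA_def RB_def)
          moreover from this have "links E' A B (W \<union> W')"
            unfolding links_def using conn_Un[OF E', of W W'] by blast
          ultimately show False using X(2) unfolding separates_def by blast
        qed
        have xRA: "x \<in> RA" using x Ca ab C(2) by (auto simp: RA_def intro!: exI[of _ Ca])
        have yRB: "y \<in> RB" using y Cb ab C(2) by (auto simp: RB_def intro!: exI[of _ Cb])
        have "\<exists>P'. P' \<subseteq> p s \<and> conn E' P' \<and> s \<in> P' \<and> P' \<inter> A \<noteq> {} \<and> P' - {s} \<subseteq> RA"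
          if s: "s \<in> insert x X" for s
        proof -
          have "conn E' (p s)" "p s \<inter> A \<noteq> {}" "s \<in> p s" "p s \<inter> X \<subseteq> {s}"
            using p[OF s] P(4) by (auto simp: links_def)
          from conn_trim[OF E' this] show ?thesis unfolding RA_def .
        qed
        then obtain p' where p': "\<And>s. s \<in> insert x X \<Longrightarrow> p' s \<subseteq> p s \<and> conn E' (p' s) \<and> s \<in> p' s \<and>
            p' s \<inter> A \<noteq> {} \<and> p' s - {s} \<subseteq> RA" by metis
        have "\<exists>P'. P' \<subseteq> q s \<and> conn E' P' \<and> s \<in> P' \<and> P' \<inter> B \<noteq> {} \<and> P' - {s} \<subseteq> RB"
          if s: "s \<in> insert y X" for s
        proof -
          have "conn E' (q s)" "q s \<inter> B \<noteq> {}" "s \<in> q s" "q s \<inter> X \<subseteq> {s}"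
            using q[OF s] Q(4) by (auto simp: links_def)
          from conn_trim[OF E' this] show ?thesis unfolding RB_def .
        qed
        then obtain q' where q': "\<And>s. s \<in> insert y X \<Longrightarrow> q' s \<subseteq> q s \<and> conn E' (q' s) \<and> s \<in> q' s \<and>
            q' s \<inter> B \<noteq> {} \<and> q' s - {s} \<subseteq> RB" by metis
        \<comment> \<open>Left pieces end in \<open>insert x X\<close>, right pieces begin in
          \<open>insert y X\<close>. The pairing sends \<open>x\<close> to \<open>y\<close>, to be
          joined by the deleted edge, and fixes every vertex of \<open>X\<close>.\<close>
        define \<tau> where "\<tau> s = (if s = x then y else s)" for s
        have \<tau>: "\<tau> s \<in> insert y X" if "s \<in> insert x X" for s using that by (auto simp: \<tau>_def)
        have \<tau>_inj: "\<tau> s \<noteq> \<tau> s'" if "s \<in> insert x X" "s' \<in> insert x X" "s \<noteq> s'" for s s'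
          using that nX by (auto simp: \<tau>_def)
        define F where "F s = p' s \<union> q' (\<tau> s)" for s
        \<comment> \<open>Apart from its end, a left piece lies in \<open>RA\<close> and a right
          piece in \<open>RB\<close>; \<open>x\<close> and \<open>y\<close> lie there too. A common
          vertex therefore belongs to \<open>X\<close> and is the end of both pieces, which makes
          them partners.\<close>
        have pq: "p' s \<inter> q' (\<tau> s') = {}" if s: "s \<in> insert x X" "s' \<in> insert x X" "s \<noteq> s'" for s s'
        proof (rule ccontr)
          assume "p' s \<inter> q' (\<tau> s') \<noteq> {}"
          then obtain w where w: "w \<in> p' s" "w \<in> q' (\<tau> s')" by blast
          have w1: "w = s \<or> w \<in> RA" and w2: "w = \<tau> s' \<or> w \<in> RB"
            using w p'[OF s(1)] q'[OF \<tau>[OF s(2)]] by blast+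
          have XR: "X \<inter> RA = {}" "X \<inter> RB = {}" by (auto simp: RA_def RB_def)
          have "w \<in> RA \<or> w \<in> X" using w1 s(1) xRA by auto
          moreover have "w \<in> RB \<or> w \<in> X" using w2 \<tau>[OF s(2)] yRB by auto
          ultimately have "w \<in> X" using RAB by blast
          then have "w = s" "w = \<tau> s'" using w1 w2 XR by auto
          then show False using s \<open>w \<in> X\<close> nX by (auto simp: \<tau>_def split: if_splits)
        qed
        have Fdis: "F s \<inter> F s' = {}" if s: "s \<in> insert x X" "s' \<in> insert x X" "s \<noteq> s'" for s s'
        proof -
          have "p s \<noteq> p s'" using p[OF s(1)] p[OF s(2)] s(3) by auto
          then have "p s \<inter> p s' = {}" using p[OF s(1)] p[OF s(2)] P(3) by (auto simp: pairwise_def disjnt_def)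
          then have 1: "p' s \<inter> p' s' = {}" using p'[OF s(1)] p'[OF s(2)] by blast
          have "q (\<tau> s) \<noteq> q (\<tau> s')" using q[OF \<tau>[OF s(1)]] q[OF \<tau>[OF s(2)]] \<tau>_inj[OF s] by auto
          then have "q (\<tau> s) \<inter> q (\<tau> s') = {}"
            using q[OF \<tau>[OF s(1)]] q[OF \<tau>[OF s(2)]] Q(3) by (auto simp: pairwise_def disjnt_def)
          then have "q' (\<tau> s) \<inter> q' (\<tau> s') = {}" using q'[OF \<tau>[OF s(1)]] q'[OF \<tau>[OF s(2)]] by blast
          with 1 pq[OF s] pq[OF s(2) s(1) s(3)[symmetric]] show ?thesis unfolding F_def by blast
        qed
        have Fl: "links E A B (F s)" if s: "s \<in> insert x X" for s
        proof -
          have c: "conn E (p' s)" "conn E (q' (\<tau> s))"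
            using p'[OF s] q'[OF \<tau>[OF s]] conn_mono[OF _ sub] by auto
          have m: "s \<in> p' s" "\<tau> s \<in> q' (\<tau> s)" using p'[OF s] q'[OF \<tau>[OF s]] by auto
          have "p' s \<inter> q' (\<tau> s) \<noteq> {} \<or> (\<exists>a\<in>p' s. \<exists>b\<in>q' (\<tau> s). (a, b) \<in> E)"
            using m xy unfolding \<tau>_def by (cases "s = x") auto
          from conn_Un[OF E c this] show ?thesis
            using p'[OF s] q'[OF \<tau>[OF s]] unfolding links_def F_def by blast
        qed
        have "inj_on F (insert x X)"
        proof (rule inj_onI)
          fix s s' assume s: "s \<in> insert x X" "s' \<in> insert x X" "F s = F s'"
          have "F s \<noteq> {}" using Fl[OF s(1)] by (auto simp: links_def)
          with Fdis[OF s(1,2)] s(3) show "s = s'" by blast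
        qed
        then have "card (F ` insert x X) = m" using cardX(1) card_image by metis
        moreover have "pairwise disjnt (F ` insert x X)"
          unfolding pairwise_image disjnt_def using Fdis by (auto simp: pairwise_def)
        ultimately show ?thesis
          using X(1) Fl by (intro exI[of _ "F ` insert x X"]) blast
      qed
      show ?thesis
        using oa
      proof
        assume "x \<in> Ca"
        then have "y \<in> Cb" using ob dis by auto
        with \<open>x \<in> Ca\<close> show ?thesis using main[of x y] xy E'_def by blast
      next
        assume "y \<in> Ca"
        then have "x \<in> Cb" using ob dis by auto
        moreover have "(y, x) \<in> E" using xy E by (auto simp: sym_def)
        ultimately show ?thesis using main[of y x] \<open>y \<in> Ca\<close> E'_def by blast
      qed
    qed
  qed
qed


subsection \<open>Necklaces\<close>

text \<open>Only arcs from \<open>A\<close> to \<open>B\<close> count, so for disjoint sets two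
  different arcs are two different undirected edges and not the two directions of one.\<close>

definition double_link :: "('a \<times> 'a) set \<Rightarrow> 'a set \<Rightarrow> 'a set \<Rightarrow> bool" where
  "double_link E A B \<longleftrightarrow> (\<exists>e\<in>E \<inter> A \<times> B. \<exists>f\<in>E \<inter> A \<times> B. e \<noteq> f)"

definition necklace :: "'a set \<Rightarrow> ('a \<times> 'a) set \<Rightarrow> nat \<Rightarrow> (nat \<Rightarrow> 'a set) \<Rightarrow> bool" where
  "necklace V E n S \<longleftrightarrow> (\<forall>i<n. conn E (S i) \<and> S i \<subseteq> V) \<and>
     (\<forall>i<n. \<forall>j<n. i \<noteq> j \<longrightarrow> S i \<inter> S j = {}) \<and>
     (\<forall>i. Suc i < n \<longrightarrow> double_link E (S i) (S (Suc i)))"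

lemma double_linkI:
  "(u, v) \<in> E \<Longrightarrow> (x, y) \<in> E \<Longrightarrow> u \<in> A \<Longrightarrow> x \<in> A \<Longrightarrow> v \<in> B \<Longrightarrow> y \<in> B \<Longrightarrow> u \<noteq> x \<or> v \<noteq> y \<Longrightarrow>
    double_link E A B"
  unfolding double_link_def by blast

text \<open>Search from \<open>y\<close> as in depth-first search: the members avoiding
  \<open>y\<close> meet one another, hence lie in one component of \<open>D - {y}\<close>. The path
  enters this component through a neighbour of \<open>y\<close> and from there on only has to meet
  these members.\<close>

lemma bramble_path:
  assumes "sym E" "finite D" "conn E D" "y \<in> D"
    and "\<And>B. B \<in> \<B> \<Longrightarrow> conn E B \<and> B \<subseteq> D"
    and "\<And>B B'. B \<in> \<B> \<Longrightarrow> B' \<in> \<B> \<Longrightarrow> B \<inter> B' \<noteq> {}"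
  shows "\<exists>xs. xs \<noteq> [] \<and> hd xs = y \<and> distinct xs \<and> successively (\<lambda>u v. (u, v) \<in> E) xs \<and>
    set xs \<subseteq> D \<and> (\<forall>B\<in>\<B>. B \<inter> set xs \<noteq> {})"
  using assms(2-)
proof (induction "card D" arbitrary: D y \<B> rule: less_induct)
  case less
  show ?case
  proof (cases "\<forall>B\<in>\<B>. y \<in> B")
    case True
    then show ?thesis using less.prems(3) by (intro exI[of _ "[y]"]) auto
  next
    case False
    then obtain B0 where B0: "B0 \<in> \<B>" "y \<notin> B0" by blast
    then obtain b where b: "b \<in> B0" using less.prems(4)[of B0] by (auto simp: conn_def)
    have bD: "b \<in> D - {y}" using b B0 less.prems(4)[of B0] by auto
    define D' where "D' = component E (D - {y}) b"
    have D': "conn E D'" "D' \<subseteq> D - {y}" "b \<in> D'"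
      using conn_component[OF assms(1) bD] in_component_self[OF bD] component_subset[of E "D - {y}" b]
      by (auto simp: D'_def)
    have sub: "B \<subseteq> D'" if "B \<in> \<B>" "y \<notin> B" "B \<inter> D' \<noteq> {}" for B
      unfolding D'_def using that less.prems(4)[of B]
      by (intro conn_subset_component) (auto simp: D'_def)
    have B0': "B0 \<subseteq> D'" using sub[OF B0] b D' by auto
    obtain a c where ac: "a \<in> D'" "c \<in> D - D'" "(a, c) \<in> E"
      using conn_cut[OF less.prems(2), of D'] D' less.prems(3) by auto
    then have "c = y" using component_closed[of a E "D - {y}" b c] by (auto simp: D'_def)
    then have ya: "(y, a) \<in> E" using ac assms(1) by (auto simp: sym_def)
    define \<B>' where "\<B>' = {B \<in> \<B>. y \<notin> B}"
    have "\<exists>xs. xs \<noteq> [] \<and> hd xs = a \<and> distinct xs \<and> successively (\<lambda>u v. (u, v) \<in> E) xs \<and>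
        set xs \<subseteq> D' \<and> (\<forall>B\<in>\<B>'. B \<inter> set xs \<noteq> {})"
    proof (rule less.hyps)
      show "card D' < card D"
        using less.prems(1,3) D' by (intro psubset_card_mono) auto
      show "finite D'" using less.prems(1) D' finite_subset by blast
      show "conn E B \<and> B \<subseteq> D'" if "B \<in> \<B>'" for B
        using that less.prems(4,5) B0 B0' sub[of B] by (auto simp: \<B>'_def) blast
      show "B \<inter> B' \<noteq> {}" if "B \<in> \<B>'" "B' \<in> \<B>'" for B B'
        using that less.prems(5) by (auto simp: \<B>'_def)
    qed (use D' ac in auto)
    then obtain xs where xs: "xs \<noteq> []" "hd xs = a" "distinct xs" "successively (\<lambda>u v. (u, v) \<in> E) xs"
      "set xs \<subseteq> D'" "\<forall>B\<in>\<B>'. B \<inter> set xs \<noteq> {}" by blast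
    have "distinct (y # xs)" using xs D' by auto
    moreover have "successively (\<lambda>u v. (u, v) \<in> E) (y # xs)"
      using xs ya by (auto simp: successively_Cons)
    moreover have "set (y # xs) \<subseteq> D" using xs D' less.prems(3) by auto
    moreover have "\<forall>B\<in>\<B>. B \<inter> set (y # xs) \<noteq> {}"
      using xs(6) by (auto simp: \<B>'_def)
    ultimately show ?thesis by (intro exI[of _ "y # xs"]) simp
  qed
qed

section \<open>From ladders to necklaces\<close>

definition segment :: "'a list \<Rightarrow> nat \<Rightarrow> nat \<Rightarrow> 'a set" where
  "segment xs l u = (\<lambda>k. xs ! k) ` {l..<u}"

lemma conn_segment:
  assumes "sym E" "successively (\<lambda>u v. (u, v) \<in> E) xs" "l < u" "u \<le> length xs"
  shows "conn E (segment xs l u)"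
  using assms(3,4)
proof (induction u)
  case (Suc u)
  show ?case
  proof (cases "l = u")
    case True
    then show ?thesis by (simp add: segment_def)
  next
    case False
    with Suc have IH: "conn E (segment xs l u)" and lu: "l < u" by auto
    have "(xs ! (u - 1), xs ! u) \<in> E"
      using assms(2) Suc.prems lu successively_conv_nth[of "\<lambda>u v. (u, v) \<in> E" xs]
      by (metis Suc_diff_1 Suc_le_lessD not_less_zero gr0I)
    moreover have "xs ! (u - 1) \<in> segment xs l u" using lu by (auto simp: segment_def)
    moreover have "segment xs l (Suc u) = insert (xs ! u) (segment xs l u)"
      using lu by (simp add: segment_def atLeastLessThanSuc)
    ultimately show ?thesis using conn_insert[OF assms(1) IH] by simp
  qed
qed simp

text \<open>The rails are \<open>ps\<close> and \<open>qs\<close>, the rungs \<open>C 0\<close> to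
  \<open>C n\<close>. A piece is a rung together with the stretches of both rails from its feet up
  to, but excluding, the feet of the next rung; consecutive pieces are then joined by one edge of
  each rail. The last rung only bounds the last piece, so n + 1 rungs give n pieces.\<close>

lemma ladder_necklace:
  assumes E: "sym E"
    and ps: "distinct ps" "successively (\<lambda>u v. (u, v) \<in> E) ps" "set ps \<subseteq> V"
    and qs: "distinct qs" "successively (\<lambda>u v. (u, v) \<in> E) qs" "set qs \<subseteq> V"
    and pq: "set ps \<inter> set qs = {}"
    and a: "\<And>i j. i < j \<Longrightarrow> j \<le> n \<Longrightarrow> a i < a j" "a n < length ps"
    and b: "\<And>i j. i < j \<Longrightarrow> j \<le> n \<Longrightarrow> b i < b j" "b n < length qs"
    and C: "\<And>i. i \<le> n \<Longrightarrow> conn E (C i) \<and> C i \<subseteq> V \<and> C i \<inter> set ps = {ps ! a i} \<and> C i \<inter> set qs = {qs ! b i}"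
    and dis: "\<And>i j. i \<le> n \<Longrightarrow> j \<le> n \<Longrightarrow> i \<noteq> j \<Longrightarrow> C i \<inter> C j = {}"
  shows "\<exists>S. necklace V E n S"
proof -
  define S where "S i = C i \<union> segment ps (a i) (a (Suc i)) \<union> segment qs (b i) (b (Suc i))" for i
  have al: "a i < length ps" "b i < length qs" if "i \<le> n" for i
    using a(1)[of i n] a(2) b(1)[of i n] b(2) that by (cases "i = n"; auto)+
  have amono: "a i \<le> a j" "b i \<le> b j" if "i \<le> j" "j \<le> n" for i j
    using a(1)[of i j] b(1)[of i j] that by (cases "i = j"; auto)+
  have segp: "segment ps (a i) (a (Suc i)) \<subseteq> set ps" if "i < n" for i
    using al[of "Suc i"] that by (auto simp: segment_def)
  have segq: "segment qs (b i) (b (Suc i)) \<subseteq> set qs" if "i < n" for i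
    using al[of "Suc i"] that by (auto simp: segment_def)
  \<comment> \<open>A rung meets a rail only in its foot, so a rung meeting the stretch of another
    piece would have its foot there, against the order of the feet.\<close>
  have inp: "j = i" if ij: "i < n" "j \<le> n" "ps ! a j \<in> segment ps (a i) (a (Suc i))" for i j
  proof -
    obtain k where k: "a i \<le> k" "k < a (Suc i)" "ps ! a j = ps ! k" using ij(3) by (auto simp: segment_def)
    then have "k = a j" using ps(1) al[of j] al[of "Suc i"] that by (auto simp: nth_eq_iff_index_eq)
    then show ?thesis
      using k a(1)[of j i] amono(1)[of "Suc i" j] that by (cases i j rule: linorder_cases) auto
  qed
  have inq: "j = i" if ij: "i < n" "j \<le> n" "qs ! b j \<in> segment qs (b i) (b (Suc i))" for i j
  proof -
    obtain k where k: "b i \<le> k" "k < b (Suc i)" "qs ! b j = qs ! k" using ij(3) by (auto simp: segment_def)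
    then have "k = b j" using qs(1) al[of j] al[of "Suc i"] that by (auto simp: nth_eq_iff_index_eq)
    then show ?thesis
      using k b(1)[of j i] amono(2)[of "Suc i" j] that by (cases i j rule: linorder_cases) auto
  qed
  have sp: "segment ps (a i) (a (Suc i)) \<inter> segment ps (a j) (a (Suc j)) = {}" if "i < j" "j < n" for i j
  proof -
    have "k \<noteq> l" if "k \<in> {a i..<a (Suc i)}" "l \<in> {a j..<a (Suc j)}" for k l
      using that amono(1)[of "Suc i" j] \<open>i < j\<close> \<open>j < n\<close> by auto
    moreover have "k < length ps" if "k < a (Suc i) \<or> k < a (Suc j)" for k
      using that al[of "Suc i"] al[of "Suc j"] \<open>i < j\<close> \<open>j < n\<close> by auto
    ultimately show ?thesis using ps(1) by (auto simp: segment_def nth_eq_iff_index_eq)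
  qed
  have sq: "segment qs (b i) (b (Suc i)) \<inter> segment qs (b j) (b (Suc j)) = {}" if "i < j" "j < n" for i j
  proof -
    have "k \<noteq> l" if "k \<in> {b i..<b (Suc i)}" "l \<in> {b j..<b (Suc j)}" for k l
      using that amono(2)[of "Suc i" j] \<open>i < j\<close> \<open>j < n\<close> by auto
    moreover have "k < length qs" if "k < b (Suc i) \<or> k < b (Suc j)" for k
      using that al[of "Suc i"] al[of "Suc j"] \<open>i < j\<close> \<open>j < n\<close> by auto
    ultimately show ?thesis using qs(1) by (auto simp: segment_def nth_eq_iff_index_eq)
  qed
  have Cp: "C j \<inter> segment ps (a i) (a (Suc i)) = {}" if "i < n" "j < n" "i \<noteq> j" for i j
  proof (rule ccontr)
    assume "\<not> ?thesis"
    then obtain x where x: "x \<in> C j" "x \<in> segment ps (a i) (a (Suc i))" by blast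
    then have "x \<in> C j \<inter> set ps" using segp[OF that(1)] by blast
    then have "x = ps ! a j" using C[of j] that by auto
    then show False using inp[of i j] x that by auto
  qed
  have Cq: "C j \<inter> segment qs (b i) (b (Suc i)) = {}" if "i < n" "j < n" "i \<noteq> j" for i j
  proof (rule ccontr)
    assume "\<not> ?thesis"
    then obtain x where x: "x \<in> C j" "x \<in> segment qs (b i) (b (Suc i))" by blast
    then have "x \<in> C j \<inter> set qs" using segq[OF that(1)] by blast
    then have "x = qs ! b j" using C[of j] that by auto
    then show False using inq[of i j] x that by auto
  qed
  have lt: "S i \<inter> S j = {}" if ij: "i < j" "j < n" for i j
  proof -
    have i: "i < n" using ij by simp
    have "C i \<inter> C j = {}" using dis[of i j] ij by simp
    moreover have "C i \<inter> segment ps (a j) (a (Suc j)) = {}" "C i \<inter> segment qs (b j) (b (Suc j)) = {}"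
      "C j \<inter> segment ps (a i) (a (Suc i)) = {}" "C j \<inter> segment qs (b i) (b (Suc i)) = {}"
      using Cp Cq i ij by auto
    moreover have "segment ps (a i) (a (Suc i)) \<inter> segment qs (b j) (b (Suc j)) = {}"
      "segment qs (b i) (b (Suc i)) \<inter> segment ps (a j) (a (Suc j)) = {}"
      using segp[OF i] segp[OF ij(2)] segq[OF i] segq[OF ij(2)] pq by blast+
    ultimately show ?thesis
      unfolding S_def Int_Un_distrib Int_Un_distrib2 using sp[OF ij] sq[OF ij] by (simp add: Int_commute)
  qed
  have "conn E (S i) \<and> S i \<subseteq> V" if i: "i < n" for i
  proof -
    have ai: "a i < a (Suc i)" "b i < b (Suc i)" using a(1) b(1) i by auto
    have "ps ! a i \<in> C i \<inter> segment ps (a i) (a (Suc i))"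
      using C[of i] i ai by (auto simp: segment_def)
    moreover have "conn E (segment ps (a i) (a (Suc i)))" "conn E (segment qs (b i) (b (Suc i)))"
      using conn_segment[OF E ps(2) ai(1)] conn_segment[OF E qs(2) ai(2)] al[of "Suc i"] i by auto
    ultimately have 1: "conn E (C i \<union> segment ps (a i) (a (Suc i)))"
      and 2: "conn E (segment qs (b i) (b (Suc i)))"
      using conn_Un[OF E, of "C i"] C[of i] i by auto
    have "qs ! b i \<in> C i \<inter> segment qs (b i) (b (Suc i))"
      using C[of i] i ai by (auto simp: segment_def)
    then have "conn E (S i)"
      unfolding S_def using conn_Un[OF E 1 2] by blast
    then show ?thesis
      using C[of i] segp[OF i] segq[OF i] ps(3) qs(3) i by (auto simp: S_def)
  qed
  moreover have "double_link E (S i) (S (Suc i))" if i: "Suc i < n" for i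
  proof -
    have ai: "a i < a (Suc i)" "b i < b (Suc i)" using a(1) b(1) i by auto
    have l: "a (Suc i) < length ps" "b (Suc i) < length qs" using al[of "Suc i"] i by auto
    obtain k where "a (Suc i) = Suc k" using ai by (cases "a (Suc i)") auto
    moreover obtain l where "b (Suc i) = Suc l" using ai by (cases "b (Suc i)") auto
    ultimately have kl: "a (Suc i) = Suc k" "b (Suc i) = Suc l" .
    have "(ps ! k, ps ! Suc k) \<in> E" "(qs ! l, qs ! Suc l) \<in> E"
      using ps(2) qs(2) l kl by (auto simp: successively_conv_nth)
    moreover have "ps ! k \<in> S i" "qs ! l \<in> S i" using ai kl by (auto simp: S_def segment_def)
    moreover have "ps ! Suc k \<in> S (Suc i)" "qs ! Suc l \<in> S (Suc i)"
      using C[of "Suc i"] i kl by (auto simp: S_def)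
    moreover have "ps ! k \<noteq> qs ! l"
    proof -
      have "ps ! k \<in> set ps" "qs ! l \<in> set qs" using kl l by auto
      with pq show ?thesis by auto
    qed
    ultimately show ?thesis by (intro double_linkI[of "ps ! k" "ps ! Suc k" E "qs ! l" "qs ! Suc l"]) auto
  qed
  moreover have "S i \<inter> S j = {}" if "i < n" "j < n" "i \<noteq> j" for i j
    using lt[of i j] lt[of j i] that Int_commute[of "S i" "S j"] by (metis linorder_neqE_nat)
  ultimately show ?thesis unfolding necklace_def by blast
qed

section \<open>Monotone selection by Ramsey's theorem\<close>

definition monotone_selecting :: "nat \<Rightarrow> nat \<Rightarrow> bool" where
  "monotone_selecting n m \<longleftrightarrow>
    (\<forall>(a :: nat \<Rightarrow> nat) (b :: nat \<Rightarrow> nat). inj_on a {..<m} \<and> inj_on b {..<m} \<longrightarrow>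
    (\<exists>r. (\<forall>i<n. r i < m) \<and> (\<forall>i j. i < j \<and> j < n \<longrightarrow> a (r i) < a (r j)) \<and>
      ((\<forall>i j. i < j \<and> j < n \<longrightarrow> b (r i) < b (r j)) \<or> (\<forall>i j. i < j \<and> j < n \<longrightarrow> b (r j) < b (r i)))))"

text \<open>The Erdos-Szekeres property. Ramsey's theorem is applied to the graph joining two
  indices that \<open>a\<close> and \<open>b\<close> order alike: on a clique \<open>b\<close>
  increases with \<open>a\<close>, on an independent set it decreases. Listing the indices by
  increasing \<open>a\<close> gives \<open>r\<close>.\<close>

lemma monotone_selection:
  fixes n :: nat
  shows "\<exists>m. monotone_selecting n m"
proof -
  obtain m where m: "\<And>(V::nat set) (E::nat set set). finite V \<Longrightarrow> card V \<ge> m \<Longrightarrow>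
    \<exists>R \<subseteq> V. card R = n \<and> clique R E \<or> card R = n \<and> indep R E"
    using ramsey2[of n n] by blast
  show ?thesis
    unfolding monotone_selecting_def
  proof (intro exI[of _ m] allI impI, elim conjE)
    fix a b :: "nat \<Rightarrow> nat" assume inj: "inj_on a {..<m}" "inj_on b {..<m}"
    define E where "E = {{i, j} | i j. a i < a j \<and> b i < b j}"
    obtain R where R: "R \<subseteq> {..<m}" "card R = n" "clique R E \<or> indep R E"
      using m[of "{..<m}" E] by auto
    have finR: "finite R" using R(1) finite_subset by blast
    define L where "L = sorted_list_of_set (a ` R)"
    have L: "set L = a ` R" "length L = n" "sorted_wrt (<) L"
      using finR R inj(1) by (auto simp: L_def card_image inj_on_subset)
    define r where "r i = inv_into R a (L ! i)" for i
    have r: "r i \<in> R" "a (r i) = L ! i" if "i < n" for i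
    proof -
      have "L ! i \<in> a ` R" using L that by (metis nth_mem)
      then show "r i \<in> R" "a (r i) = L ! i" by (auto simp: r_def inv_into_into f_inv_into_f)
    qed
    have ar: "a (r i) < a (r j)" if "i < j" "j < n" for i j
      using r[of i] r[of j] that L by (auto simp: sorted_wrt_iff_nth_less)
    have ne: "r i \<noteq> r j" if "i < j" "j < n" for i j using ar[OF that] by auto
    have "(\<forall>i j. i < j \<and> j < n \<longrightarrow> b (r i) < b (r j)) \<or> (\<forall>i j. i < j \<and> j < n \<longrightarrow> b (r j) < b (r i))"
      using R(3)
    proof
      assume "clique R E"
      then have "{r i, r j} \<in> E" if "i < j" "j < n" for i j
        using r[of i] r[of j] ne[OF that] that by (auto simp: clique_def)
      then have "b (r i) < b (r j)" if "i < j" "j < n" for i j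
        using ar[OF that] that by (fastforce simp: E_def doubleton_eq_iff)
      then show ?thesis by blast
    next
      assume "indep R E"
      then have nE: "{r i, r j} \<notin> E" if "i < j" "j < n" for i j
        using r[of i] r[of j] ne[OF that] that by (auto simp: indep_def)
      have "b (r j) < b (r i)" if ij: "i < j" "j < n" for i j
      proof -
        have "\<not> b (r i) < b (r j)" using nE[OF ij] ar[OF ij] unfolding E_def by blast
        moreover have "b (r i) \<noteq> b (r j)"
          using inj(2) r[of i] r[of j] ne[OF ij] ij R(1) by (meson inj_onD less_trans subsetD)
        ultimately show ?thesis by simp
      qed
      then show ?thesis by blast
    qed
    then show "\<exists>r. (\<forall>i<n. r i < m) \<and> (\<forall>i j. i < j \<and> j < n \<longrightarrow> a (r i) < a (r j)) \<and>
      ((\<forall>i j. i < j \<and> j < n \<longrightarrow> b (r i) < b (r j)) \<or> (\<forall>i j. i < j \<and> j < n \<longrightarrow> b (r j) < b (r i)))"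
      using r(1) R(1) ar by (intro exI[of _ r]) auto
  qed
qed

text \<open>If \<open>C\<close> meets \<open>A\<close> in two vertices, split it into connected
  parts containing one each: both parts meet \<open>A\<close> and at least one meets
  \<open>B\<close>, so a smaller linking set remains. The same works with \<open>A\<close> and
  \<open>B\<close> exchanged.\<close>

lemma links_single:
  assumes E: "sym E" and "finite C" "links E A B C"
  shows "\<exists>C' p q. C' \<subseteq> C \<and> conn E C' \<and> C' \<inter> A = {p} \<and> C' \<inter> B = {q}"
  using assms(2,3)
proof (induction "card C" arbitrary: C rule: less_induct)
  case less
  obtain p q where pq: "p \<in> C \<inter> A" "q \<in> C \<inter> B" using less.prems(2) by (auto simp: links_def)
  show ?case
  proof (cases "C \<inter> A = {p} \<and> C \<inter> B = {q}")
    case True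
    then show ?thesis using less.prems(2) by (auto simp: links_def)
  next
    case False
    have smaller: "\<exists>D. D \<subset> C \<and> links E A B D"
      if xy: "x \<in> C" "y \<in> C" "x \<noteq> y" and AB: "x \<in> A \<and> y \<in> A \<or> x \<in> B \<and> y \<in> B" for x y
    proof -
      obtain X Y where XY: "x \<in> X" "y \<in> Y" "conn E X" "conn E Y" "X \<inter> Y = {}" "X \<union> Y = C"
        using conn_split[OF E less.prems(1) _ xy] less.prems(2) by (auto simp: links_def)
      then have "X \<subset> C" "Y \<subset> C" by auto
      moreover have "links E A B X \<or> links E A B Y"
        using AB
      proof
        assume "x \<in> A \<and> y \<in> A"
        then have "X \<inter> A \<noteq> {}" "Y \<inter> A \<noteq> {}" "X \<inter> B \<noteq> {} \<or> Y \<inter> B \<noteq> {}" using XY pq by blast+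
        with XY show ?thesis by (auto simp: links_def)
      next
        assume "x \<in> B \<and> y \<in> B"
        then have "X \<inter> B \<noteq> {}" "Y \<inter> B \<noteq> {}" "X \<inter> A \<noteq> {} \<or> Y \<inter> A \<noteq> {}" using XY pq by blast+
        with XY show ?thesis by (auto simp: links_def)
      qed
      ultimately show ?thesis by blast
    qed
    from False pq obtain z where "z \<in> C \<inter> A \<and> z \<noteq> p \<or> z \<in> C \<inter> B \<and> z \<noteq> q" by blast
    then have "\<exists>D. D \<subset> C \<and> links E A B D"
      using smaller[of z p] smaller[of z q] pq by blast
    then obtain D where D: "D \<subset> C" "links E A B D" by (elim exE conjE)
    have fin: "finite D" by (rule finite_subset[OF _ less.prems(1)]) (use D(1) in blast)
    have card: "card D < card C" by (rule psubset_card_mono[OF less.prems(1) D(1)])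
    from less.hyps[OF card fin D(2)] obtain C' p' q'
      where "C' \<subseteq> D" "conn E C'" "C' \<inter> A = {p'}" "C' \<inter> B = {q'}" by (elim exE conjE)
    with D(1) show ?thesis by (intro exI[of _ C'] exI[of _ p'] exI[of _ q']) auto
  qed
qed

text \<open>\<open>conn\<close> does not confine a set to the graph, since every singleton satisfies
  it; this places the linking sets from \<open>menger_conn\<close> inside \<open>V\<close>.\<close>

lemma conn_subset_vertices:
  assumes "conn E C" "E \<subseteq> V \<times> V" "C \<inter> V \<noteq> {}"
  shows "C \<subseteq> V"
proof (rule ccontr)
  assume "\<not> C \<subseteq> V"
  then obtain a b where "a \<in> C \<inter> V" "b \<in> C - (C \<inter> V)" "(a, b) \<in> E"
    using conn_cut[OF assms(1), of "C \<inter> V"] assms(3) by blast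
  with assms(2) show False by blast
qed

text \<open>Trimmed to single feet, disjoint linking sets have distinct feet on both paths, so n + 1
  of them can be chosen with monotone positions. If the positions on \<open>qs\<close> decrease,
  that path is traversed backwards.\<close>

lemma links_paths_necklace:
  assumes m: "monotone_selecting (Suc n) m"
    and E: "sym E" and V: "finite V" "E \<subseteq> V \<times> V"
    and ps: "distinct ps" "successively (\<lambda>u v. (u, v) \<in> E) ps" "set ps \<subseteq> V"
    and qs: "distinct qs" "successively (\<lambda>u v. (u, v) \<in> E) qs" "set qs \<subseteq> V"
    and pq: "set ps \<inter> set qs = {}"
    and \<C>: "finite \<C>" "card \<C> = m" "pairwise disjnt \<C>" "\<And>C. C \<in> \<C> \<Longrightarrow> links E (set ps) (set qs) C"
  shows "\<exists>S. necklace V E n S"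
proof -
  obtain h where h: "bij_betw h {0..<m} \<C>" using ex_bij_betw_nat_finite[OF \<C>(1)] \<C>(2) by auto
  have hC: "h i \<in> \<C>" if "i < m" for i using h that by (auto simp: bij_betw_def)
  have hdis: "h i \<inter> h j = {}" if "i < m" "j < m" "i \<noteq> j" for i j
  proof -
    have "h i \<noteq> h j" using h that by (auto simp: bij_betw_def inj_on_def)
    then show ?thesis using \<C>(3) hC that by (auto simp: pairwise_def disjnt_def)
  qed
  have "\<exists>C' a b. C' \<subseteq> h i \<and> conn E C' \<and> C' \<subseteq> V \<and> a < length ps \<and> b < length qs \<and>
      C' \<inter> set ps = {ps ! a} \<and> C' \<inter> set qs = {qs ! b}" if i: "i < m" for i
  proof -
    have l: "links E (set ps) (set qs) (h i)" using \<C>(4) hC i by blast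
    have hV: "h i \<subseteq> V"
      using conn_subset_vertices[of E "h i" V] V(2) ps(3) l unfolding links_def by blast
    then have "finite (h i)" using V(1) finite_subset by blast
    from links_single[OF E this l] obtain C' p q where C': "C' \<subseteq> h i" "conn E C'"
      "C' \<inter> set ps = {p}" "C' \<inter> set qs = {q}" by blast
    then have "p \<in> set ps" "q \<in> set qs" by auto
    then obtain a b where "a < length ps" "p = ps ! a" "b < length qs" "q = qs ! b"
      by (metis in_set_conv_nth)
    with C' hV show ?thesis by blast
  qed
  then obtain C a b where C: "\<And>i. i < m \<Longrightarrow> C i \<subseteq> h i \<and> conn E (C i) \<and> C i \<subseteq> V \<and> a i < length ps \<and>
      b i < length qs \<and> C i \<inter> set ps = {ps ! a i} \<and> C i \<inter> set qs = {qs ! b i}" by metis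
  have Cdis: "C i \<inter> C j = {}" if "i < m" "j < m" "i \<noteq> j" for i j
    using hdis[OF that] C that by blast
  have inja: "inj_on a {..<m}"
  proof (rule inj_onI)
    fix i j assume ij: "i \<in> {..<m}" "j \<in> {..<m}" "a i = a j"
    then have "ps ! a i \<in> C i \<inter> C j" using C[of i] C[of j] by auto
    then show "i = j" using Cdis[of i j] ij by auto
  qed
  have injb: "inj_on b {..<m}"
  proof (rule inj_onI)
    fix i j assume ij: "i \<in> {..<m}" "j \<in> {..<m}" "b i = b j"
    then have "qs ! b i \<in> C i \<inter> C j" using C[of i] C[of j] by auto
    then show "i = j" using Cdis[of i j] ij by auto
  qed
  obtain r where r: "\<forall>i<Suc n. r i < m" "\<forall>i j. i < j \<and> j < Suc n \<longrightarrow> a (r i) < a (r j)"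
      "(\<forall>i j. i < j \<and> j < Suc n \<longrightarrow> b (r i) < b (r j)) \<or> (\<forall>i j. i < j \<and> j < Suc n \<longrightarrow> b (r j) < b (r i))"
    using m[unfolded monotone_selecting_def] inja injb by blast
  have rm: "r i < m" if "i \<le> n" for i using r(1) that by simp
  have rne: "r i \<noteq> r j" if "i \<le> n" "j \<le> n" "i \<noteq> j" for i j
    using r(2) that by (metis le_imp_less_Suc less_irrefl linorder_neqE_nat)
  from r(3) show ?thesis
  proof
    assume bm: "\<forall>i j. i < j \<and> j < Suc n \<longrightarrow> b (r i) < b (r j)"
    show ?thesis
    proof (rule ladder_necklace[OF E ps qs pq, of n "\<lambda>i. a (r i)" "\<lambda>i. b (r i)" "\<lambda>i. C (r i)"])
      show "C (r i) \<inter> C (r j) = {}" if "i \<le> n" "j \<le> n" "i \<noteq> j" for i j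
        by (rule Cdis) (use that rm rne in auto)
    qed (use r(2) bm C rm in auto)
  next
    assume bm: "\<forall>i j. i < j \<and> j < Suc n \<longrightarrow> b (r j) < b (r i)"
    have rs: "distinct (rev qs)" "set (rev qs) \<subseteq> V" "set ps \<inter> set (rev qs) = {}"
      "successively (\<lambda>u v. (u, v) \<in> E) (rev qs)"
    proof -
      have "(\<lambda>u v. (v, u) \<in> E) = (\<lambda>u v. (u, v) \<in> E)" using E by (auto simp: sym_def fun_eq_iff)
      with qs(2) show "successively (\<lambda>u v. (u, v) \<in> E) (rev qs)" by (simp only: successively_rev)
    qed (use qs pq in auto)
    have rn: "rev qs ! (length qs - Suc (b (r i))) = qs ! b (r i)" if "i \<le> n" for i
    proof -
      have "b (r i) < length qs" using C[OF rm[OF that]] by blast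
      then show ?thesis by (simp add: rev_nth)
    qed
    show ?thesis
    proof (rule ladder_necklace[OF E ps rs(1,4,2,3), of n "\<lambda>i. a (r i)" "\<lambda>i. length qs - Suc (b (r i))" "\<lambda>i. C (r i)"])
      show "C (r i) \<inter> C (r j) = {}" if "i \<le> n" "j \<le> n" "i \<noteq> j" for i j
        by (rule Cdis) (use that rm rne in auto)
      show "length qs - Suc (b (r i)) < length qs - Suc (b (r j))" if ij: "i < j" "j \<le> n" for i j
      proof -
        have "b (r j) < b (r i)" using bm ij by simp
        moreover have "b (r i) < length qs" using C[of "r i"] rm[of i] ij by simp
        ultimately show ?thesis by simp
      qed
      show "length qs - Suc (b (r n)) < length (rev qs)"
      proof -
        have "b (r n) < length qs" using C[OF rm[OF order_refl]] by blast
        then show ?thesis by simp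
      qed
    qed (use r(2) C rm rn in auto)
  qed
qed

section \<open>Hitting sets of pairwise intersecting families\<close>

definition hit_by :: "nat \<Rightarrow> 'a set set \<Rightarrow> bool" where
  "hit_by k \<B> \<longleftrightarrow> (\<exists>X. finite X \<and> card X \<le> k \<and> (\<forall>B\<in>\<B>. B \<inter> X \<noteq> {}))"

text \<open>
  A path meeting every member of a family without small hitting sets is cut into two pieces such
  that the members meeting either piece have no small hitting set. No small set separates the two
  pieces, and the paths provided by Menger's theorem contain a ladder.
\<close>

theorem bramble_hit_or_necklace:
  "\<exists>K. \<forall>V (E :: ('a \<times> 'a) set) \<B>. finite V \<and> E \<subseteq> V \<times> V \<and> sym E \<and> conn E V \<and>
     (\<forall>B\<in>\<B>. conn E B \<and> B \<subseteq> V) \<and> (\<forall>B\<in>\<B>. \<forall>B'\<in>\<B>. B \<inter> B' \<noteq> {}) \<longrightarrow>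
     hit_by K \<B> \<or> (\<exists>S. necklace V E n S)"
proof -
  obtain m where m: "monotone_selecting (Suc n) m"
    using monotone_selection[of "Suc n"] by blast
  \<comment> \<open>Selecting at least one index requires a positive \<open>m\<close>; thanks to
    this the empty prefix of the path is not hard below.\<close>
  have m0: "0 < m"
    using m[unfolded monotone_selecting_def, rule_format, of "\<lambda>x. x" "\<lambda>x. x"] by (auto simp: inj_on_def)
  show ?thesis
  proof (intro exI[of _ "2 * m"] allI impI, elim conjE)
    fix V and E :: "('a \<times> 'a) set" and \<B>
    assume V: "finite V" "E \<subseteq> V \<times> V" and E: "sym E" and cV: "conn E V"
      and B: "\<forall>B\<in>\<B>. conn E B \<and> B \<subseteq> V" and meet: "\<forall>B\<in>\<B>. \<forall>B'\<in>\<B>. B \<inter> B' \<noteq> {}"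
    have finE: "finite E" using V finite_subset by blast
    show "hit_by (2 * m) \<B> \<or> (\<exists>S. necklace V E n S)"
    proof (subst disj_commute, rule disjCI)
      assume nohit: "\<not> hit_by (2 * m) \<B>"
      obtain y where y: "y \<in> V" using cV by (auto simp: conn_def)
      obtain xs where xs: "distinct xs" "successively (\<lambda>u v. (u, v) \<in> E) xs" "set xs \<subseteq> V"
          "\<forall>B\<in>\<B>. B \<inter> set xs \<noteq> {}"
      proof -
        have "conn E B \<and> B \<subseteq> V" if "B \<in> \<B>" for B using that B by simp
        moreover have "B \<inter> B' \<noteq> {}" if "B \<in> \<B>" "B' \<in> \<B>" for B B' using that meet by simp
        ultimately have "\<exists>xs. xs \<noteq> [] \<and> hd xs = y \<and> distinct xs \<and>
          successively (\<lambda>u v. (u, v) \<in> E) xs \<and> set xs \<subseteq> V \<and> (\<forall>B\<in>\<B>. B \<inter> set xs \<noteq> {})"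
          by (rule bramble_path[OF E V(1) cV y])
        then show ?thesis using that by blast
      qed
      \<comment> \<open>Hardness of both pieces of the path is what will exclude a separator with
        fewer than \<open>m\<close> vertices.\<close>
      define hard where "hard Y \<longleftrightarrow>
        (\<forall>X. finite X \<longrightarrow> card X < m \<longrightarrow> (\<exists>B\<in>\<B>. B \<inter> Y \<noteq> {} \<and> B \<inter> X = {}))" for Y
      have "hard (set xs)"
        unfolding hard_def
      proof (intro allI impI)
        fix X :: "'a set" assume X: "finite X" "card X < m"
        then have "card X \<le> 2 * m" by simp
        with X(1) nohit have "\<exists>B\<in>\<B>. B \<inter> X = {}" unfolding hit_by_def by metis
        with xs(4) show "\<exists>B\<in>\<B>. B \<inter> set xs \<noteq> {} \<and> B \<inter> X = {}" by metis
      qed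
      then have ex: "hard (set (take (length xs) xs))" by simp
      \<comment> \<open>The shortest hard prefix: without its last vertex \<open>xs ! k'\<close>,
        the members meeting it can be hit by fewer than \<open>m\<close> vertices.\<close>
      define k where "k = (LEAST k. hard (set (take k xs)))"
      have hk: "hard (set (take k xs))" unfolding k_def using ex by (rule LeastI)
      have "\<not> hard (set (take 0 xs))"
        using m0 unfolding hard_def by (metis finite.emptyI card.empty inf_bot_right list.set(1) take_0)
      then obtain k' where k': "k = Suc k'" using hk by (cases k) auto
      then have nk': "\<not> hard (set (take k' xs))" unfolding k_def by (intro not_less_Least) simp
      then obtain X1 where X1: "finite X1" "card X1 < m"
          "\<And>B. B \<in> \<B> \<Longrightarrow> B \<inter> set (take k' xs) \<noteq> {} \<Longrightarrow> B \<inter> X1 \<noteq> {}"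
        unfolding hard_def by metis
      have k'l: "k' < length xs"
      proof (rule ccontr)
        assume "\<not> ?thesis"
        then have "take k xs = take k' xs" using k' by simp
        then show False using hk nk' by simp
      qed
      \<comment> \<open>Otherwise \<open>X1\<close> for the shorter prefix, \<open>X2\<close> for
        the suffix and the vertex \<open>xs ! k'\<close> between them hit every member; this is the
        origin of the bound \<open>2 * m\<close>.\<close>
      have hq: "hard (set (drop k xs))"
      proof (rule ccontr)
        assume "\<not> ?thesis"
        then obtain X2 where X2: "finite X2" "card X2 < m"
            "\<And>B. B \<in> \<B> \<Longrightarrow> B \<inter> set (drop k xs) \<noteq> {} \<Longrightarrow> B \<inter> X2 \<noteq> {}"
          unfolding hard_def by metis
        define X where "X = insert (xs ! k') (X1 \<union> X2)"
        have fin: "finite X" using X1 X2 by (simp add: X_def)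
        have "card X \<le> Suc (card (X1 \<union> X2))" unfolding X_def using X1 X2 by (simp add: card_insert_if)
        then have card: "card X \<le> 2 * m"
          using card_Un_le[of X1 X2] X1(2) X2(2) by linarith
        have "xs = take k' xs @ xs ! k' # drop k xs" using id_take_nth_drop[OF k'l] k' by simp
        then have "set xs = set (take k' xs @ xs ! k' # drop k xs)" by (rule arg_cong)
        then have sx: "set xs = set (take k' xs) \<union> insert (xs ! k') (set (drop k xs))"
          by (simp only: set_append list.set(2))
        have "B \<inter> X \<noteq> {}" if "B \<in> \<B>" for B
        proof -
          have "B \<inter> set xs \<noteq> {}" using xs(4) that by simp
          then have "B \<inter> set (take k' xs) \<noteq> {} \<or> xs ! k' \<in> B \<or> B \<inter> set (drop k xs) \<noteq> {}"
            unfolding sx by blast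
          then show ?thesis
            using X1(3)[OF that] X2(3)[OF that] unfolding X_def Int_insert_right Int_Un_distrib
            by (metis Un_empty insert_not_empty)
        qed
        with fin card have "hit_by (2 * m) \<B>" unfolding hit_by_def by (intro exI[of _ X]) simp
        with nohit show False by simp
      qed
      define ps where "ps = take k xs"
      define qs where "qs = drop k xs"
      have split: "xs = ps @ qs" by (simp add: ps_def qs_def)
      \<comment> \<open>A member meeting \<open>ps\<close> and one meeting \<open>qs\<close>, both
        avoiding \<open>X\<close>, intersect; their union links the two paths and avoids
        \<open>X\<close>.\<close>
      have sep: "m \<le> card X" if X: "finite X" "separates E (set ps) (set qs) X" for X
      proof (rule ccontr)
        assume "\<not> m \<le> card X"
        then have cX: "card X < m" by simp
        obtain B1 where B1: "B1 \<in> \<B>" "B1 \<inter> set ps \<noteq> {}" "B1 \<inter> X = {}"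
          using hk X(1) cX unfolding hard_def ps_def by metis
        obtain B2 where B2: "B2 \<in> \<B>" "B2 \<inter> set qs \<noteq> {}" "B2 \<inter> X = {}"
          using hq X(1) cX unfolding hard_def qs_def by metis
        have "conn E (B1 \<union> B2)" using B B1(1) B2(1) meet by (intro conn_Un[OF E]) auto
        then have "links E (set ps) (set qs) (B1 \<union> B2)" using B1 B2 by (auto simp: links_def)
        then show False using X(2) B1(3) B2(3) by (auto simp: separates_def)
      qed
      obtain \<C> where C: "finite \<C>" "card \<C> = m" "pairwise disjnt \<C>" "\<forall>C\<in>\<C>. links E (set ps) (set qs) C"
        using menger_conn[OF E finE finite_set finite_set sep] by metis
      show "\<exists>S. necklace V E n S"
        by (rule links_paths_necklace[OF m E V, of ps qs \<C>])
          (use C xs split in \<open>auto simp: successively_append_iff\<close>)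
    qed
  qed
qed


subsection \<open>Joining necklaces\<close>

lemma necklaceD:
  assumes "necklace V E n S"
  shows "i < n \<Longrightarrow> conn E (S i)" "i < n \<Longrightarrow> S i \<subseteq> V"
    "i < n \<Longrightarrow> j < n \<Longrightarrow> i \<noteq> j \<Longrightarrow> S i \<inter> S j = {}"
    "Suc i < n \<Longrightarrow> double_link E (S i) (S (Suc i))"
  using assms by (auto simp: necklace_def)

lemma necklaceI:
  assumes "\<And>i. i < n \<Longrightarrow> conn E (S i)" "\<And>i. i < n \<Longrightarrow> S i \<subseteq> V"
    "\<And>i j. i < j \<Longrightarrow> j < n \<Longrightarrow> S i \<inter> S j = {}"
    "\<And>i. Suc i < n \<Longrightarrow> double_link E (S i) (S (Suc i))"
  shows "necklace V E n S"
proof -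
  have "S i \<inter> S j = {}" if "i < n" "j < n" "i \<noteq> j" for i j
    using assms(3)[of i j] assms(3)[of j i] that Int_commute[of "S i" "S j"] by (metis linorder_neqE_nat)
  with assms show ?thesis by (simp add: necklace_def)
qed

lemma double_link_mono: "double_link E A B \<Longrightarrow> E \<subseteq> E' \<Longrightarrow> A \<subseteq> A' \<Longrightarrow> B \<subseteq> B' \<Longrightarrow> double_link E' A' B'"
  unfolding double_link_def by (meson Int_mono Sigma_mono subsetD)

lemma double_linkE:
  assumes "double_link E A B"
  obtains u v x y where "(u, v) \<in> E" "u \<in> A" "v \<in> B" "(x, y) \<in> E" "x \<in> A" "y \<in> B" "u \<noteq> x \<or> v \<noteq> y"
proof -
  obtain e f where "e \<in> E \<inter> A \<times> B" "f \<in> E \<inter> A \<times> B" "e \<noteq> f"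
    using assms unfolding double_link_def by metis
  then show ?thesis by (cases e; cases f) (auto intro: that)
qed

lemma double_link_sym:
  assumes "sym E" "double_link E A B" shows "double_link E B A"
proof -
  obtain u v x y where "(u, v) \<in> E" "u \<in> A" "v \<in> B" "(x, y) \<in> E" "x \<in> A" "y \<in> B" "u \<noteq> x \<or> v \<noteq> y"
    by (rule double_linkE[OF assms(2)])
  then show ?thesis
    using assms(1) by (intro double_linkI[of v u E y x]) (auto dest: symD)
qed

lemma necklace_mono:
  assumes "necklace V E n S" "V \<subseteq> V'" "E \<subseteq> E'"
  shows "necklace V' E' n S"
proof (rule necklaceI)
  show "double_link E' (S i) (S (Suc i))" if "Suc i < n" for i
    by (rule double_link_mono[OF necklaceD(4)[OF assms(1) that] assms(3)]) simp_all
  show "S i \<subseteq> V'" if "i < n" for i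
    by (rule order_trans[OF necklaceD(2)[OF assms(1) that] assms(2)])
qed (use necklaceD(1,3)[OF assms(1)] conn_mono[OF _ assms(3)] in auto)

lemma necklace_shift: "necklace V E n S \<Longrightarrow> l + k \<le> n \<Longrightarrow> necklace V E k (\<lambda>i. S (l + i))"
  unfolding necklace_def by auto

lemma necklace_take: "necklace V E n S \<Longrightarrow> k \<le> n \<Longrightarrow> necklace V E k S"
  unfolding necklace_def by auto

lemma necklace_rev:
  assumes "sym E" "necklace V E n S" shows "necklace V E n (\<lambda>i. S (n - Suc i))"
proof (rule necklaceI)
  show "double_link E (S (n - Suc i)) (S (n - Suc (Suc i)))" if "Suc i < n" for i
    using double_link_sym[OF assms(1) necklaceD(4)[OF assms(2), of "n - Suc (Suc i)"]] that
    by (simp add: Suc_diff_Suc)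
qed (use necklaceD[OF assms(2)] in auto)

lemma conn_necklace_Union:
  assumes "sym E" "necklace V E n S" "0 < n"
  shows "conn E (\<Union>i<n. S i)"
  using assms(3,2)
proof (induction n rule: nat_induct_non_zero)
  case 1
  then show ?case by (simp add: necklace_def lessThan_Suc)
next
  case (Suc n)
  have IH: "conn E (\<Union>i<n. S i)" using Suc.IH necklace_take[OF Suc.prems] by simp
  obtain m where m: "n = Suc m" using Suc.hyps by (cases n) auto
  have "double_link E (S m) (S n)" using necklaceD(4)[OF Suc.prems, of m] m by simp
  then obtain u v where uv: "u \<in> S m" "v \<in> S n" "(u, v) \<in> E" by (auto simp: double_link_def)
  moreover have "u \<in> (\<Union>i<n. S i)" using uv m by auto
  ultimately have "conn E ((\<Union>i<n. S i) \<union> S n)"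
    using necklaceD(1)[OF Suc.prems, of n] by (intro conn_Un[OF assms(1) IH]) auto
  then show ?case by (simp add: lessThan_Suc Un_commute)
qed

lemma necklace_append:
  assumes S: "necklace V E a S" and T: "necklace V E b T" and "0 < a"
    and dis: "\<And>i j. i < a \<Longrightarrow> j < b \<Longrightarrow> S i \<inter> T j = {}"
    and link: "0 < b \<Longrightarrow> double_link E (S (a - 1)) (T 0)"
  shows "necklace V E (a + b) (\<lambda>i. if i < a then S i else T (i - a))"
proof (rule necklaceI)
  fix i assume i: "Suc i < a + b"
  consider "Suc i < a" | "Suc i = a" | "a \<le> i" by linarith
  then show "double_link E (if i < a then S i else T (i - a)) (if Suc i < a then S (Suc i) else T (Suc i - a))"
  proof cases
    case 1
    then show ?thesis using necklaceD(4)[OF S] by simp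
  next
    case 2
    then have "a - 1 = i" "0 < b" using i by auto
    then show ?thesis using link 2 by auto
  next
    case 3
    then show ?thesis using necklaceD(4)[OF T, of "i - a"] i by (simp add: Suc_diff_le)
  qed
next
  fix i j assume "i < j" "j < a + b"
  then show "(if i < a then S i else T (i - a)) \<inter> (if j < a then S j else T (j - a)) = {}"
    using necklaceD(3)[OF S, of i j] necklaceD(3)[OF T, of "i - a" "j - a"] dis[of i "j - a"] by auto
next
  fix i assume "i < a + b"
  then show "conn E (if i < a then S i else T (i - a))" "(if i < a then S i else T (i - a)) \<subseteq> V"
    using necklaceD(1,2)[OF S, of i] necklaceD(1,2)[OF T, of "i - a"] by auto
qed

text \<open>A single edge does not give a double link, so the two end pieces are fused into one;
  this costs one piece.\<close>

lemma necklace_merge: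
  assumes E: "sym E" and S: "necklace V E a S" and T: "necklace V E b T" and ab: "0 < a" "0 < b"
    and dis: "\<And>i j. i < a \<Longrightarrow> j < b \<Longrightarrow> S i \<inter> T j = {}"
    and uv: "(u, v) \<in> E" "u \<in> S (a - 1)" "v \<in> T 0"
  shows "\<exists>R. necklace V E (a + b - 1) R"
proof -
  define S' where "S' = S(a - 1 := S (a - 1) \<union> T 0)"
  have sub: "S i \<subseteq> S' i" for i by (simp add: S'_def)
  have S': "necklace V E a S'"
  proof (rule necklaceI)
    show "conn E (S' i)" if "i < a" for i
      using that conn_Un[OF E, of "S (a - 1)" "T 0"] necklaceD(1)[OF S] necklaceD(1)[OF T] ab uv
      by (auto simp: S'_def)
    show "S' i \<subseteq> V" if "i < a" for i
      using that necklaceD(2)[OF S] necklaceD(2)[OF T] ab by (auto simp: S'_def)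
    show "S' i \<inter> S' j = {}" if ij: "i < j" "j < a" for i j
    proof -
      have "i \<noteq> a - 1" using ij by linarith
      then have "S' i = S i" by (simp add: S'_def)
      moreover have "S' j \<subseteq> S j \<union> T 0" by (simp add: S'_def)
      ultimately show ?thesis
        using necklaceD(3)[OF S, of i j] dis[of i 0] ij ab by (auto simp: disjoint_iff)
    qed
    show "double_link E (S' i) (S' (Suc i))" if "Suc i < a" for i
      by (rule double_link_mono[OF necklaceD(4)[OF S that] order_refl sub sub])
  qed
  have T': "necklace V E (b - 1) (\<lambda>i. T (1 + i))"
    by (rule necklace_shift[OF T]) (use ab in simp)
  have "necklace V E (a + (b - 1)) (\<lambda>i. if i < a then S' i else T (1 + (i - a)))"
  proof (rule necklace_append[OF S' T' ab(1)])
    show "S' i \<inter> T (1 + j) = {}" if ij: "i < a" "j < b - 1" for i j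
    proof -
      have "S' i \<subseteq> S i \<union> T 0" by (simp add: S'_def)
      moreover have "S i \<inter> T (1 + j) = {}" "T 0 \<inter> T (1 + j) = {}"
        using dis[of i "1 + j"] necklaceD(3)[OF T, of 0 "1 + j"] ij by auto
      ultimately show ?thesis by (auto simp: disjoint_iff)
    qed
    show "double_link E (S' (a - 1)) (T (1 + 0))" if "0 < b - 1"
      by (rule double_link_mono[OF necklaceD(4)[OF T, of 0]]) (use that in \<open>auto simp: S'_def\<close>)
  qed
  moreover have "a + (b - 1) = a + b - 1" using ab by simp
  ultimately show ?thesis by metis
qed

text \<open>The longer of the two parts into which a piece divides a necklace, ending at that piece.\<close>

definition arm_length :: "nat \<Rightarrow> nat \<Rightarrow> nat" where
  "arm_length n i = max (Suc i) (n - i)"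

text \<open>A prefix, or a reversed suffix when that is longer, has piece \<open>i\<close> at its
  end, where another necklace can be attached.\<close>

lemma necklace_arm:
  assumes "sym E" "necklace V E n S" "i < n"
  shows "\<exists>R. necklace V E (arm_length n i) R \<and> R (arm_length n i - 1) = S i \<and>
    (\<forall>j<arm_length n i. \<exists>l<n. R j = S l)"
proof (cases "n - i \<le> Suc i")
  case True
  then have "arm_length n i = Suc i" by (simp add: arm_length_def)
  moreover have "\<forall>j<Suc i. \<exists>l<n. S j = S l"
  proof (intro allI impI)
    show "\<exists>l<n. S j = S l" if "j < Suc i" for j using that assms(3) by (intro exI[of _ j]) auto
  qed
  ultimately show ?thesis
    using necklace_take[OF assms(2), of "Suc i"] assms(3) by (intro exI[of _ S]) auto
next
  case False
  then have a: "arm_length n i = n - i" by (simp add: arm_length_def)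
  have "necklace V E (n - i) (\<lambda>j. S (n - Suc j))"
    using necklace_take[OF necklace_rev[OF assms(1,2)], of "n - i"] by simp
  moreover have "S (n - Suc (n - i - 1)) = S i" using assms(3) by (simp add: Suc_diff_Suc)
  moreover have "\<forall>j<n - i. \<exists>l<n. S (n - Suc j) = S l"
  proof (intro allI impI)
    show "\<exists>l<n. S (n - Suc j) = S l" for j using assms(3) by (intro exI[of _ "n - Suc j"]) auto
  qed
  ultimately show ?thesis unfolding a by (intro exI[of _ "\<lambda>j. S (n - Suc j)"]) auto
qed

text \<open>The second arm is reversed so that \<open>T j\<close> comes first. A double link keeps
  all pieces, a single edge loses one by \<open>necklace_merge\<close>.\<close>

lemma join_arms:
  assumes E: "sym E" and S: "necklace V E n S" and T: "necklace V E n T"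
    and dis: "\<And>i j. i < n \<Longrightarrow> j < n \<Longrightarrow> S i \<inter> T j = {}"
    and ij: "i < n" "j < n"
  shows "double_link E (S i) (T j) \<Longrightarrow> \<exists>R. necklace V E (arm_length n i + arm_length n j) R"
    and "(u, v) \<in> E \<Longrightarrow> u \<in> S i \<Longrightarrow> v \<in> T j \<Longrightarrow>
      \<exists>R. necklace V E (arm_length n i + arm_length n j - 1) R"
proof -
  define a b where "a = arm_length n i" and "b = arm_length n j"
  have ab: "0 < a" "0 < b" by (auto simp: a_def b_def arm_length_def)
  obtain P where P: "necklace V E a P" "P (a - 1) = S i" "\<forall>k<a. \<exists>l<n. P k = S l"
    using necklace_arm[OF E S ij(1)] unfolding a_def by metis
  obtain Q where Q: "necklace V E b Q" "Q (b - 1) = T j" "\<forall>k<b. \<exists>l<n. Q k = T l"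
    using necklace_arm[OF E T ij(2)] unfolding b_def by metis
  define Q' where "Q' k = Q (b - Suc k)" for k
  have Q': "necklace V E b Q'" unfolding Q'_def by (rule necklace_rev[OF E Q(1)])
  have Q'0: "Q' 0 = T j" using Q(2) by (simp add: Q'_def)
  have d: "P k \<inter> Q' l = {}" if "k < a" "l < b" for k l
  proof -
    have "\<exists>k'<n. P k = S k'" "\<exists>l'<n. Q' l = T l'" using P(3) Q(3) that by (auto simp: Q'_def)
    then show ?thesis using dis by metis
  qed
  show "\<exists>R. necklace V E (arm_length n i + arm_length n j) R" if "double_link E (S i) (T j)"
    using necklace_append[OF P(1) Q' ab(1) d] that P(2) Q'0 unfolding a_def[symmetric] b_def[symmetric]
    by auto
  show "\<exists>R. necklace V E (arm_length n i + arm_length n j - 1) R"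
    if "(u, v) \<in> E" "u \<in> S i" "v \<in> T j"
    using necklace_merge[OF E P(1) Q' ab d that(1)] that P(2) Q'0
    unfolding a_def[symmetric] b_def[symmetric] by auto
qed

text \<open>
  The pieces of the two necklaces are grown to a partition of \<open>V\<close>, so that two edges cross between the
  necklaces. If these join the same two pieces, the link is double; otherwise one of them avoids the
  middle piece of one necklace, which makes the longer part on that side more than half.
\<close>

lemma disjoint_necklaces:
  assumes V: "finite V" and E: "sym E" and cV: "conn E V"
    and bridgeless: "\<And>A. A \<subseteq> V \<Longrightarrow> A \<noteq> {} \<Longrightarrow> A \<noteq> V \<Longrightarrow> double_link E A (V - A)"
    and n: "0 < n" and S: "necklace V E n S" and T: "necklace V E n T"
    and dis: "(\<Union>i<n. S i) \<inter> (\<Union>i<n. T i) = {}"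
  shows "\<exists>R. necklace V E (Suc n) R"
proof -
  have ST: "S i \<inter> T j = {}" if "i < n" "j < n" for i j
  proof -
    have "S i \<subseteq> (\<Union>i<n. S i)" "T j \<subseteq> (\<Union>i<n. T i)" using that by auto
    with dis show ?thesis by (metis Int_mono subset_empty)
  qed
  \<comment> \<open>Tagging the pieces by their necklace makes one family of both, so a single use
    of \<open>conn_grow\<close> extends all pieces and keeps them disjoint.\<close>
  define P where "P x = (if fst x then S (snd x) else T (snd x))" for x :: "bool \<times> nat"
  define I where "I = (UNIV :: bool set) \<times> {..<n}"
  have "\<exists>Q. (\<forall>x\<in>I. P x \<subseteq> Q x \<and> conn E (Q x)) \<and> (\<forall>x\<in>I. \<forall>y\<in>I. x \<noteq> y \<longrightarrow> Q x \<inter> Q y = {}) \<and>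
    (\<Union>x\<in>I. Q x) = V"
  proof (rule conn_grow[OF E V cV])
    show "I \<noteq> {}" using n by (auto simp: I_def)
    show "conn E (P x)" "P x \<subseteq> V" if "x \<in> I" for x
      using that necklaceD(1,2)[OF S, of "snd x"] necklaceD(1,2)[OF T, of "snd x"] by (auto simp: P_def I_def)
    show "P x \<inter> P y = {}" if xy: "x \<in> I" "y \<in> I" "x \<noteq> y" for x y
    proof (cases "fst x = fst y")
      case True
      then have "snd x \<noteq> snd y" using xy by (auto simp: prod_eq_iff)
      then show ?thesis
        using True xy necklaceD(3)[OF S, of "snd x" "snd y"] necklaceD(3)[OF T, of "snd x" "snd y"]
        by (auto simp: P_def I_def)
    next
      case False
      then show ?thesis
        using xy ST[of "snd x" "snd y"] ST[of "snd y" "snd x"]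
        by (auto simp: P_def I_def Int_commute split: if_splits)
    qed
  qed
  then obtain Q where Q: "\<And>x. x \<in> I \<Longrightarrow> P x \<subseteq> Q x" "\<And>x. x \<in> I \<Longrightarrow> conn E (Q x)"
      "\<And>x y. x \<in> I \<Longrightarrow> y \<in> I \<Longrightarrow> x \<noteq> y \<Longrightarrow> Q x \<inter> Q y = {}" "(\<Union>x\<in>I. Q x) = V" by metis
  define S' where "S' i = Q (True, i)" for i
  define T' where "T' i = Q (False, i)" for i
  have inI: "(b, i) \<in> I" if "i < n" for b i using that by (simp add: I_def)
  have S': "necklace V E n S'"
  proof (rule necklaceI)
    show "double_link E (S' i) (S' (Suc i))" if "Suc i < n" for i
      by (rule double_link_mono[OF necklaceD(4)[OF S that] order_refl])
        (use Q(1)[of "(True, i)"] Q(1)[of "(True, Suc i)"] that in \<open>auto simp: S'_def P_def I_def\<close>)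
  qed (use Q(2-4) in \<open>auto simp: S'_def inI\<close>)
  have T': "necklace V E n T'"
  proof (rule necklaceI)
    show "double_link E (T' i) (T' (Suc i))" if "Suc i < n" for i
      by (rule double_link_mono[OF necklaceD(4)[OF T that] order_refl])
        (use Q(1)[of "(False, i)"] Q(1)[of "(False, Suc i)"] that in \<open>auto simp: T'_def P_def I_def\<close>)
  qed (use Q(2-4) in \<open>auto simp: T'_def inI\<close>)
  have dis': "S' i \<inter> T' j = {}" if "i < n" "j < n" for i j
    using Q(3)[of "(True, i)" "(False, j)"] that by (auto simp: S'_def T'_def inI)
  define A where "A = (\<Union>i<n. S' i)"
  have I: "I = Pair True ` {..<n} \<union> Pair False ` {..<n}"
    by (auto simp: I_def image_iff)
  have VA: "V = A \<union> (\<Union>i<n. T' i)"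
    unfolding Q(4)[symmetric] A_def S'_def T'_def I by auto
  have "A \<inter> (\<Union>i<n. T' i) = {}" using dis' by (auto simp: A_def disjoint_iff)
  then have VmA: "V - A = (\<Union>i<n. T' i)" using VA by (auto simp: disjoint_iff)
  have "S' 0 \<noteq> {}" "T' 0 \<noteq> {}" using necklaceD(1)[OF S' n] necklaceD(1)[OF T' n] by (auto simp: conn_def)
  then have "A \<noteq> {}" "V - A \<noteq> {}" using n unfolding VmA by (auto simp: A_def)
  then have dl: "double_link E A (V - A)" using bridgeless[of A] VA by auto
  obtain u v x y where uv: "(u, v) \<in> E" "u \<in> A" "v \<in> V - A"
    and xy: "(x, y) \<in> E" "x \<in> A" "y \<in> V - A" and ne: "u \<noteq> x \<or> v \<noteq> y"
    by (rule double_linkE[OF dl])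
  obtain i j where ij: "i < n" "j < n" "u \<in> S' i" "v \<in> T' j" using uv unfolding VmA by (auto simp: A_def)
  obtain k l where kl: "k < n" "l < n" "x \<in> S' k" "y \<in> T' l" using xy unfolding VmA by (auto simp: A_def)
  have done_ge: ?thesis if "necklace V E m R" "Suc n \<le> m" for m R
    using necklace_take[OF that] by blast
  note join = join_arms[OF E S' T' dis']
  show ?thesis
  proof (cases "i = k \<and> j = l")
    case True
    then have "double_link E (S' i) (T' j)"
      using uv xy ij kl ne by (intro double_linkI[of u v E x y]) auto
    then obtain R where "necklace V E (arm_length n i + arm_length n j) R" using join(1) ij by blast
    then show ?thesis by (rule done_ge) (auto simp: arm_length_def)
  next
    case False
    \<comment> \<open>\<open>arm_length n i\<close> is at least (n + 1) / 2, with equality only at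
      the middle piece of an odd \<open>n\<close>. The two pairs of pieces differ, so some pair does
      not consist of two middle pieces, and its arms have at least n + 2 pieces together.\<close>
    then have "Suc n \<le> arm_length n i + arm_length n j - 1 \<or> Suc n \<le> arm_length n k + arm_length n l - 1"
      using ij kl by (auto simp: arm_length_def max_def)
    then show ?thesis
    proof
      assume *: "Suc n \<le> arm_length n i + arm_length n j - 1"
      obtain R where "necklace V E (arm_length n i + arm_length n j - 1) R"
        using join(2)[OF _ _ ij(1,2) uv(1) ij(3,4)] by blast
      then show ?thesis by (rule done_ge[OF _ *])
    next
      assume *: "Suc n \<le> arm_length n k + arm_length n l - 1"
      obtain R where "necklace V E (arm_length n k + arm_length n l - 1) R"
        using join(2)[OF _ _ kl(1,2) xy(1) kl(3,4)] by blast
      then show ?thesis by (rule done_ge[OF _ *])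
    qed
  qed
qed


subsection \<open>Bridges and their contraction\<close>

lemma pair_graph_facts:
  assumes "pair_graph G"
  shows "sym (parcs G)" "finite (pverts G)" "finite (parcs G)" "parcs G \<subseteq> pverts G \<times> pverts G"
    "(x, x) \<notin> parcs G"
proof -
  interpret pair_graph G by fact
  show "sym (parcs G)" by (auto simp: sym_def arcs_symmetric)
  show "finite (pverts G)" "finite (parcs G)" "(x, x) \<notin> parcs G" by (auto dest: no_loops')
  show "parcs G \<subseteq> pverts G \<times> pverts G" by (auto dest: wellformed')
qed

lemma connected_iff_conn:
  assumes "pair_graph G"
  shows "connected (with_proj G) \<longleftrightarrow> conn (parcs G) (pverts G)"
proof -
  have "parcs (mk_symmetric (with_proj G)) = parcs G"
    using pair_graph_facts(1)[OF assms] by (auto simp: parcs_mk_symmetric dest: symD)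
  then show ?thesis
    by (simp add: connected_def strongly_connected_def reachable_def conn_def)
qed

lemma component_eq:
  assumes "sym E" "y \<in> component E V x" shows "component E V y = component E V x"
proof -
  have xy: "(x, y) \<in> rtrancl_on V E" using assms(2) by (simp add: component_def)
  have yx: "(y, x) \<in> rtrancl_on V E" by (rule symD[OF rtrancl_on_sym[OF assms(1)] xy])
  show ?thesis
    unfolding component_def using rtrancl_on_trans[OF xy] rtrancl_on_trans[OF yx] by auto
qed

lemma components_eq:
  assumes "sym (parcs G)"
  shows "components G = component (parcs G) (pverts G) ` pverts G"
proof (intro equalityI subsetI)
  let ?R = "rtrancl_on (pverts G) (parcs G)"
  fix C assume C: "C \<in> components G"
  have ne: "C \<noteq> {}" and in_C: "\<And>u v. u \<in> C \<Longrightarrow> v \<in> C \<Longrightarrow> (u, v) \<in> ?R"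
    and out: "\<And>u v. u \<in> C \<Longrightarrow> v \<notin> C \<Longrightarrow> (u, v) \<notin> ?R \<or> (v, u) \<notin> ?R"
    using C by (auto simp: pre_digraph.sccs_verts_def reachable_def)
  obtain u where u: "u \<in> C" using ne by auto
  have "v \<in> C" if "(u, v) \<in> ?R" for v
    using out[OF u] that symD[OF rtrancl_on_sym[OF assms] that] by auto
  then have "C = component (parcs G) (pverts G) u" using in_C[OF u] by (auto simp: component_def)
  moreover have "u \<in> pverts G" using in_C[OF u u] by (auto dest: in_rtrancl_on_in_F)
  ultimately show "C \<in> component (parcs G) (pverts G) ` pverts G" by blast
next
  fix C assume "C \<in> component (parcs G) (pverts G) ` pverts G"
  then obtain u where u: "u \<in> pverts G" "C = component (parcs G) (pverts G) u" by auto
  have *: "component (parcs G) (pverts G) v = C" if "v \<in> C" for v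
    using component_eq[OF assms] that unfolding u(2) by simp
  have "(v, w) \<in> rtrancl_on (pverts G) (parcs G) \<longleftrightarrow> w \<in> C" if "v \<in> C" for v w
    using *[OF that] by (auto simp: component_def)
  moreover have "C \<noteq> {}" using in_component_self[OF u(1)] u(2) by auto
  ultimately show "C \<in> components G"
    by (auto simp: pre_digraph.sccs_verts_def reachable_def)
qed

text \<open>If \<open>u\<close> still reaches \<open>v\<close> after the deletion, reachability does
  not change at all. Otherwise the map \<open>f\<close> from the new components to the old ones is
  onto but identifies those of \<open>u\<close> and \<open>v\<close>, so the number has
  grown.\<close>

lemma bridge_iff:
  assumes G: "pair_graph G"
  shows "bridge G (u, v) \<longleftrightarrow>
    (u, v) \<in> parcs G \<and> (u, v) \<notin> rtrancl_on (pverts G) (parcs G - {(u, v), (v, u)})"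
proof (cases "(u, v) \<in> parcs G")
  case True
  define V E E' where "V = pverts G" and "E = parcs G" and "E' = parcs G - {(u, v), (v, u)}"
  have E: "sym E" "E \<subseteq> V \<times> V" and V: "finite V"
    using pair_graph_facts[OF G] by (auto simp: V_def E_def)
  have E': "sym E'" using E by (auto simp: E'_def E_def sym_def)
  have uv: "u \<in> V" "v \<in> V" "(u, v) \<in> E" using True E by (auto simp: E_def)
  have del: "pverts (delete_edge G (u, v)) = V" "parcs (delete_edge G (u, v)) = E'"
    by (auto simp: delete_edge_def V_def E'_def)
  have comps: "components G = component E V ` V"
    using components_eq E(1) by (simp add: E_def V_def)
  have comps': "components (delete_edge G (u, v)) = component E' V ` V"
    using components_eq[of "delete_edge G (u, v)"] E' by (simp add: del)
  have "card (component E V ` V) < card (component E' V ` V) \<longleftrightarrow> (u, v) \<notin> rtrancl_on V E'"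
  proof
    assume *: "card (component E V ` V) < card (component E' V ` V)"
    show "(u, v) \<notin> rtrancl_on V E'"
    proof
      assume r: "(u, v) \<in> rtrancl_on V E'"
      have arc: "(a, b) \<in> rtrancl_on V E'" if "(a, b) \<in> E" for a b
      proof (cases "(a, b) \<in> E'")
        case True
        have "a \<in> V" "b \<in> V" using that E by auto
        then show ?thesis using rtrancl_on_into_rtrancl_on[OF rtrancl_on_refl True] by blast
      next
        case False
        then have "(a, b) = (u, v) \<or> (a, b) = (v, u)" using that by (auto simp: E'_def E_def)
        then show ?thesis using r symD[OF rtrancl_on_sym[OF E'] r] by auto
      qed
      have "(x, y) \<in> rtrancl_on V E'" if "(x, y) \<in> rtrancl_on V E" for x y
        using that
      proof (induction rule: rtrancl_on_induct)
        case (step y z)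
        then show ?case using rtrancl_on_trans arc by metis
      qed simp
      moreover have "E' \<subseteq> E" by (auto simp: E'_def E_def)
      then have "(x, y) \<in> rtrancl_on V E" if "(x, y) \<in> rtrancl_on V E'" for x y
        by (rule rtrancl_on_mono[OF _ order_refl that])
      ultimately have "component E V = component E' V" by (auto simp: component_def fun_eq_iff)
      with * show False by simp
    qed
  next
    assume r: "(u, v) \<notin> rtrancl_on V E'"
    define f where "f C = (\<Union>x\<in>C. component E V x)" for C
    have sub: "E' \<subseteq> E" by (auto simp: E'_def E_def)
    have f: "f (component E' V x) = component E V x" if x: "x \<in> V" for x
    proof -
      have same: "component E V y = component E V x" if "y \<in> component E' V x" for y
      proof (rule component_eq[OF E(1)])
        show "y \<in> component E V x" using that rtrancl_on_mono[OF sub order_refl] by (auto simp: component_def)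
      qed
      have "f (component E' V x) = (\<Union>y\<in>component E' V x. component E V x)"
        unfolding f_def by (rule SUP_cong[OF refl]) (rule same)
      moreover have "component E' V x \<noteq> {}" using in_component_self[OF x] by auto
      ultimately show ?thesis by simp
    qed
    have im: "component E V ` V = f ` (component E' V ` V)" using f by (simp add: image_image)
    have "v \<in> component E V u" using uv in_component_self[OF uv(1)] component_closed by metis
    then have "component E V v = component E V u" by (rule component_eq[OF E(1)])
    then have "f (component E' V u) = f (component E' V v)" using f uv by simp
    moreover have "component E' V u \<noteq> component E' V v" using r in_component_self[OF uv(2), of E'] by (auto simp: component_def)
    ultimately have "\<not> inj_on f (component E' V ` V)" using uv by (auto simp: inj_on_def)
    then have "card (f ` (component E' V ` V)) \<noteq> card (component E' V ` V)"
      using eq_card_imp_inj_on V by blast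
    then show "card (component E V ` V) < card (component E' V ` V)"
      unfolding im using card_image_le[of "component E' V ` V" f] V by simp
  qed
  then show ?thesis
    unfolding bridge_def comps comps' using True by (simp add: V_def E'_def)
qed (simp add: bridge_def)

text \<open>Cut the walk after its last visit to \<open>u\<close>.\<close>

lemma rtrancl_on_leave:
  assumes "(u, p) \<in> rtrancl_on W R" "u \<noteq> p"
  shows "\<exists>d. (u, d) \<in> R \<and> (d, p) \<in> rtrancl_on (W - {u}) R"
proof -
  have "(x \<noteq> u \<and> (x, p) \<in> rtrancl_on (W - {u}) R) \<or>
      (\<exists>d. (u, d) \<in> R \<and> (d, p) \<in> rtrancl_on (W - {u}) R)" if "(x, p) \<in> rtrancl_on W R" for x
    using that
  proof (induction rule: converse_rtrancl_on_induct)
    case base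
    then show ?case using assms(2) by auto
  next
    case (step x y)
    show ?case
    proof (cases "\<exists>d. (u, d) \<in> R \<and> (d, p) \<in> rtrancl_on (W - {u}) R")
      case False
      then have y: "y \<noteq> u" "(y, p) \<in> rtrancl_on (W - {u}) R" using step.IH by auto
      then have "x \<noteq> u" using step.hyps(1) False by auto
      then show ?thesis
        using converse_rtrancl_on_into_rtrancl_on[OF step.hyps(1) y(2)] step.hyps by simp
    qed simp
  qed
  from this[OF assms(1)] show ?thesis by simp
qed

section \<open>Necklaces and cuts under contraction of bridges\<close>

definition contract_preimage :: "'a pair_pre_digraph \<Rightarrow> 'a set \<Rightarrow> 'a set" where
  "contract_preimage G S = {w \<in> pverts G. contract_rep G {e. bridge G e} w \<in> S}"

context
  fixes G :: "'a pair_pre_digraph"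
  assumes G: "pair_graph G"
begin

private abbreviation (input) "V \<equiv> pverts G"
private abbreviation (input) "E \<equiv> parcs G"
private abbreviation (input) "B \<equiv> {e. bridge G e}"
private abbreviation (input) "\<rho> \<equiv> contract_rep G B"

lemma sym_bridges: "sym B"
  using pair_graph_facts(1)[OF G] symD[OF rtrancl_on_sym]
  by (auto simp: sym_def bridge_def delete_edge_def insert_commute)

lemma bridges_subset: "B \<subseteq> E"
  by (auto simp: bridge_def)

lemma contract_rep_bridges_eq_iff:
  assumes "u \<in> V" "v \<in> V"
  shows "\<rho> u = \<rho> v \<longleftrightarrow> (u, v) \<in> rtrancl_on V B"
  using contract_rep_eq_iff[OF sym_bridges assms] by (simp add: reachable_def)

lemma contract_rep_bridge: "bridge G (u, v) \<Longrightarrow> \<rho> u = \<rho> v"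
proof -
  assume b: "bridge G (u, v)"
  then have uv: "u \<in> V" "v \<in> V" using bridges_subset pair_graph_facts(4)[OF G] by auto
  have "(u, v) \<in> rtrancl_on V B"
    using rtrancl_on_into_rtrancl_on[OF rtrancl_on_refl[OF uv(1)], of v B] b uv by simp
  then show ?thesis using contract_rep_bridges_eq_iff[OF uv] by simp
qed

text \<open>Let \<open>d\<close> follow the last visit to \<open>u\<close> on a walk of bridges to
  \<open>p\<close>. The rest of the walk joins \<open>d\<close> to \<open>p\<close> without the edge
  \<open>u d\<close>; if \<open>u\<close> still reached \<open>p\<close> without it, then it would
  reach \<open>d\<close> as well, and \<open>u d\<close> would not be a bridge.\<close>

lemma bridge_path_separated:
  assumes "(u, p) \<in> rtrancl_on V B" "u \<noteq> p"
  shows "\<exists>d. bridge G (u, d) \<and> (u, p) \<notin> rtrancl_on V (E - {(u, d), (d, u)})"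
proof -
  obtain d where d: "(u, d) \<in> B" "(d, p) \<in> rtrancl_on (V - {u}) B"
    using rtrancl_on_leave[OF assms] by blast
  define E' where "E' = E - {(u, d), (d, u)}"
  have E': "sym E'" using pair_graph_facts(1)[OF G] by (auto simp: E'_def sym_def)
  have "(d, p) \<in> rtrancl_on V E'"
    using d(2)
  proof (induction rule: rtrancl_on_induct)
    case base then show ?case by simp
  next
    case (step y z)
    then have "(y, z) \<in> E'" using bridges_subset by (auto simp: E'_def)
    then show ?case using step rtrancl_on_into_rtrancl_on by fastforce
  qed
  then have pd: "(p, d) \<in> rtrancl_on V E'" by (rule symD[OF rtrancl_on_sym[OF E']])
  have "(u, d) \<notin> rtrancl_on V E'" using d(1) bridge_iff[OF G] by (simp add: E'_def)
  then have "(u, p) \<notin> rtrancl_on V E'" using rtrancl_on_trans[OF _ pd] by blast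
  with d(1) show ?thesis unfolding E'_def by auto
qed

text \<open>
  Otherwise a bridge separating \<open>u\<close> from \<open>p\<close> would lie on a cycle through \<open>(u, v)\<close> and \<open>(p, q)\<close>.
\<close>

lemma contract_arc_unique:
  assumes uv: "(u, v) \<in> E" and pq: "(p, q) \<in> E"
    and eq: "\<rho> u = \<rho> p" "\<rho> v = \<rho> q" "\<rho> u \<noteq> \<rho> v"
  shows "u = p"
proof (rule ccontr)
  assume ne: "u \<noteq> p"
  have mem: "u \<in> V" "v \<in> V" "p \<in> V" "q \<in> V" using uv pq pair_graph_facts(4)[OF G] by auto
  have "(u, p) \<in> rtrancl_on V B" using contract_rep_bridges_eq_iff mem eq(1) by simp
  from bridge_path_separated[OF this ne] obtain d where d: "bridge G (u, d)"
    "(u, p) \<notin> rtrancl_on V (E - {(u, d), (d, u)})" by blast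
  define E' where "E' = E - {(u, d), (d, u)}"
  have \<rho>d: "\<rho> d = \<rho> u" using contract_rep_bridge[OF d(1)] by simp
  have "(u, v) \<in> E'" "(q, p) \<in> E'"
    using uv symD[OF pair_graph_facts(1)[OF G] pq] eq \<rho>d by (auto simp: E'_def)
  have vq: "(v, q) \<in> rtrancl_on V B" using contract_rep_bridges_eq_iff mem eq(2) by simp
  \<comment> \<open>Both ends of the bridge \<open>u d\<close> are contracted to
    \<open>\<rho> u\<close>, so a walk of bridges from \<open>v\<close>, which stays in a different
    class, cannot use it.\<close>
  have "\<rho> w = \<rho> v \<and> (v, w) \<in> rtrancl_on V E'" if "(v, w) \<in> rtrancl_on V B" for w
    using that
  proof (induction rule: rtrancl_on_induct)
    case base then show ?case by simp
  next
    case (step y z)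
    have "\<rho> y = \<rho> z" using contract_rep_bridge step(2) by simp
    then have z: "\<rho> z = \<rho> v" using step by simp
    have "(y, z) \<in> E'" using bridges_subset step eq(3) \<rho>d z by (auto simp: E'_def)
    then show ?case using z step rtrancl_on_into_rtrancl_on by fastforce
  qed
  from this[OF vq] have "(v, q) \<in> rtrancl_on V E'" by simp
  then have "(u, q) \<in> rtrancl_on V E'"
    using converse_rtrancl_on_into_rtrancl_on \<open>(u, v) \<in> E'\<close> mem by metis
  then have "(u, p) \<in> rtrancl_on V E'"
    using rtrancl_on_into_rtrancl_on \<open>(q, p) \<in> E'\<close> mem by metis
  with d(2) show False by (simp add: E'_def)
qed

private abbreviation (input) "V' \<equiv> pverts (contract_bridges G)"
private abbreviation (input) "E' \<equiv> parcs (contract_bridges G)"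

lemma pverts_contract_bridges: "V' = \<rho> ` V"
  by (simp add: contract_bridges_def contract_def)

lemma parcs_contract_bridges_iff:
  "(a, b) \<in> E' \<longleftrightarrow> (\<exists>u v. (u, v) \<in> E \<and> \<rho> u = a \<and> \<rho> v = b \<and> a \<noteq> b)"
  by (auto simp: contract_bridges_def contract_def)

lemma pair_graph_contract_bridges: "pair_graph (contract_bridges G)"
  unfolding contract_bridges_def by (rule pair_graph_contract[OF G])

text \<open>A fibre is connected by the bridges contracted in it, and walking along bridges never
  changes the value of \<rho>.\<close>

lemma rtrancl_on_fibre:
  assumes "u \<in> V" "v \<in> V" "\<rho> u = \<rho> v" "\<rho> u \<in> S"
  shows "(u, v) \<in> rtrancl_on (contract_preimage G S) E"
proof -
  have *: "\<rho> w = \<rho> u \<and> (u, w) \<in> rtrancl_on (contract_preimage G S) E" if "(u, w) \<in> rtrancl_on V B" for w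
    using that
  proof (induction rule: rtrancl_on_induct)
    case base then show ?case using assms by (simp add: contract_preimage_def)
  next
    case (step y z)
    have "\<rho> z = \<rho> u" using contract_rep_bridge step(2,5) by simp
    moreover from this have "z \<in> contract_preimage G S" using step assms by (simp add: contract_preimage_def)
    moreover have "(y, z) \<in> E" using step(2) bridges_subset by auto
    ultimately show ?case using step(5) rtrancl_on_into_rtrancl_on by metis
  qed
  have "(u, v) \<in> rtrancl_on V B" using contract_rep_bridges_eq_iff[OF assms(1,2)] assms(3) by metis
  from conjunct2[OF *[OF this]] show ?thesis .
qed

lemma conn_contract_preimage:
  assumes S: "conn E' S" "S \<subseteq> V'"
  shows "conn E (contract_preimage G S)"
proof -
  obtain s where s: "s \<in> S" using S(1) by (auto simp: conn_def)
  then obtain r where r: "r \<in> V" "\<rho> r = s" using S(2) pverts_contract_bridges by auto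
  \<comment> \<open>The claim covers the entire fibre over \<open>y\<close>, since the next arc of
    the walk may lift to an arc leaving from any of its vertices.\<close>
  have *: "\<forall>w\<in>V. \<rho> w = y \<longrightarrow> (r, w) \<in> rtrancl_on (contract_preimage G S) E"
    if "(s, y) \<in> rtrancl_on S E'" for y
    using that
  proof (induction rule: rtrancl_on_induct)
    case base
    then show ?case using rtrancl_on_fibre[OF r(1)] r(2) by simp
  next
    case (step y z)
    obtain u v where uv: "(u, v) \<in> E" "\<rho> u = y" "\<rho> v = z"
      using step(2) parcs_contract_bridges_iff by blast
    have V: "u \<in> V" "v \<in> V" using uv pair_graph_facts(4)[OF G] by auto
    have "(r, u) \<in> rtrancl_on (contract_preimage G S) E" using step uv V by blast
    moreover have "v \<in> contract_preimage G S" using V uv step by (simp add: contract_preimage_def)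
    ultimately have rv: "(r, v) \<in> rtrancl_on (contract_preimage G S) E"
      using rtrancl_on_into_rtrancl_on uv(1) by metis
    show ?case
    proof (intro ballI impI)
      fix w assume w: "w \<in> V" "\<rho> w = z"
      have "(v, w) \<in> rtrancl_on (contract_preimage G S) E"
        using rtrancl_on_fibre[OF V(2) w(1)] w uv step by simp
      then show "(r, w) \<in> rtrancl_on (contract_preimage G S) E" by (rule rtrancl_on_trans[OF rv])
    qed
  qed
  show ?thesis
  proof (rule connI_root[OF pair_graph_facts(1)[OF G]])
    show "r \<in> contract_preimage G S" using r s by (simp add: contract_preimage_def)
    show "(r, v) \<in> rtrancl_on (contract_preimage G S) E" if "v \<in> contract_preimage G S" for v
    proof -
      have "v \<in> V" "\<rho> v \<in> S" using that by (auto simp: contract_preimage_def)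
      then show ?thesis using * S(1) s by (auto simp: conn_def)
    qed
  qed
qed

text \<open>Different arcs of the contracted graph lift to different arcs of \<open>G\<close>, so
  double links survive. The absence of necklaces and hitting sets for them both pass to the
  contracted graph by this lemma.\<close>

lemma necklace_contract_preimage:
  assumes "necklace V' E' n S"
  shows "necklace V E n (\<lambda>i. contract_preimage G (S i))"
proof (rule necklaceI)
  show "double_link E (contract_preimage G (S i)) (contract_preimage G (S (Suc i)))" if "Suc i < n" for i
  proof (rule double_linkE[OF necklaceD(4)[OF assms that]])
    fix a b c d assume *: "(a, b) \<in> E'" "a \<in> S i" "b \<in> S (Suc i)" "(c, d) \<in> E'" "c \<in> S i" "d \<in> S (Suc i)"
      "a \<noteq> c \<or> b \<noteq> d"
    obtain u v where uv: "(u, v) \<in> E" "\<rho> u = a" "\<rho> v = b" using *(1) parcs_contract_bridges_iff by blast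
    obtain x y where xy: "(x, y) \<in> E" "\<rho> x = c" "\<rho> y = d" using *(4) parcs_contract_bridges_iff by blast
    have "u \<in> V" "v \<in> V" "x \<in> V" "y \<in> V" using uv xy pair_graph_facts(4)[OF G] by auto
    then show ?thesis
      using uv xy * by (intro double_linkI[of u v E x y]) (auto simp: contract_preimage_def)
  qed
  show "contract_preimage G (S i) \<inter> contract_preimage G (S j) = {}" if "i < j" "j < n" for i j
    using necklaceD(3)[OF assms, of i j] that by (auto simp: contract_preimage_def)
  show "contract_preimage G (S i) \<subseteq> V" for i by (auto simp: contract_preimage_def)
qed (use conn_contract_preimage necklaceD[OF assms] in auto)

lemma conn_contract_bridges:
  assumes "conn E V" shows "conn E' V'"
proof -
  have "(\<rho> u, \<rho> v) \<in> rtrancl_on V' E'" if "(u, v) \<in> rtrancl_on V E" for u v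
    using that
  proof (induction rule: rtrancl_on_induct)
    case base then show ?case by (simp add: pverts_contract_bridges)
  next
    case (step y z)
    show ?case
    proof (cases "\<rho> y = \<rho> z")
      case False
      then have "(\<rho> y, \<rho> z) \<in> E'" using step(2) parcs_contract_bridges_iff by blast
      moreover have "\<rho> z \<in> V'" using step by (simp add: pverts_contract_bridges)
      ultimately show ?thesis using step(5) rtrancl_on_into_rtrancl_on by metis
    qed (use step in simp)
  qed
  then show ?thesis using assms by (auto simp: conn_def pverts_contract_bridges)
qed

text \<open>An arc \<open>(u, v)\<close> across the cut is no bridge, so another walk from
  \<open>u\<close> to \<open>v\<close> crosses the cut by a second arc. Contraction drops parallel
  edges, and \<open>contract_arc_unique\<close> is what guarantees that the two arcs do not become
  one.\<close>

lemma contract_bridges_bridgeless: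
  assumes "conn E V" "A \<subseteq> V'" "A \<noteq> {}" "A \<noteq> V'"
  shows "double_link E' A (V' - A)"
proof -
  obtain a b where ab: "a \<in> A" "b \<in> V' - A" "(a, b) \<in> E'"
    using conn_cut[OF conn_contract_bridges[OF assms(1)] assms(2-)] by blast
  obtain u v where uv: "(u, v) \<in> E" "\<rho> u = a" "\<rho> v = b" "a \<noteq> b"
    using ab(3) parcs_contract_bridges_iff by blast
  have "\<not> bridge G (u, v)" using contract_rep_bridge uv by blast
  then have r: "(u, v) \<in> rtrancl_on V (E - {(u, v), (v, u)})" using bridge_iff[OF G] uv(1) by simp
  have "\<exists>p q. (p, q) \<in> E - {(u, v), (v, u)} \<and> \<rho> p \<in> A \<and> \<rho> q \<notin> A"
  proof (rule ccontr)
    assume *: "\<not> ?thesis"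
    have "\<rho> v \<in> A"
      using r
    proof (induction rule: rtrancl_on_induct)
      case base then show ?case using ab uv by simp
    next
      case (step y z) then show ?case using * by blast
    qed
    then show False using ab uv by simp
  qed
  then obtain p q where pq: "(p, q) \<in> E" "(p, q) \<noteq> (u, v)" "\<rho> p \<in> A" "\<rho> q \<notin> A" by blast
  have V: "p \<in> V" "q \<in> V" using pq pair_graph_facts(4)[OF G] by auto
  have arc: "(\<rho> p, \<rho> q) \<in> E'" using pq parcs_contract_bridges_iff by metis
  have "\<rho> p \<noteq> a \<or> \<rho> q \<noteq> b"
  proof (rule ccontr)
    assume "\<not> ?thesis"
    then have eq: "\<rho> u = \<rho> p" "\<rho> v = \<rho> q" "\<rho> u \<noteq> \<rho> v" using uv by auto
    have "u = p" using contract_arc_unique[OF uv(1) pq(1) eq] .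
    moreover have "v = q"
      by (rule contract_arc_unique[of v u q p])
        (use eq symD[OF pair_graph_facts(1)[OF G]] uv(1) pq(1) in auto)
    ultimately show False using pq(2) by simp
  qed
  then show ?thesis
    using ab arc pq V by (intro double_linkI[of a b E' "\<rho> p" "\<rho> q"]) (auto simp: pverts_contract_bridges)
qed

end


subsection \<open>Bounding bridge-depth\<close>

lemma bridge_depth_connected_le:
  assumes "pair_graph G" "conn (parcs G) (pverts G)" "v \<in> pverts (contract_bridges G)"
  shows "bridge_depth G \<le> 1 + bridge_depth (delete_verts (contract_bridges G) {v})"
proof -
  have fin: "finite (pverts (contract_bridges G))"
    by (rule pair_graph_facts(2)[OF pair_graph_contract_bridges[OF assms(1)]])
  have "bridge_depth G = 1 + Min ((\<lambda>v. bridge_depth (delete_verts (contract_bridges G) {v}))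
      ` pverts (contract_bridges G))"
    using assms(2) connected_iff_conn[OF assms(1)] pair_graph_facts(2)[OF assms(1)] conn_nonempty
    by (subst bridge_depth.simps) auto
  moreover have "Min ((\<lambda>v. bridge_depth (delete_verts (contract_bridges G) {v}))
      ` pverts (contract_bridges G)) \<le> bridge_depth (delete_verts (contract_bridges G) {v})"
    using fin assms(3) by (intro Min_le) auto
  ultimately show ?thesis by simp
qed

lemma bridge_depth_le_components:
  assumes G: "pair_graph G"
    and c: "\<And>C. C \<in> components G \<Longrightarrow> bridge_depth (induced G C) \<le> c"
  shows "bridge_depth G \<le> c"
proof -
  note comps = components_eq[OF pair_graph_facts(1)[OF G]]
  consider "pverts G = {}" | "pverts G \<noteq> {}" "connected (with_proj G)"
    | "pverts G \<noteq> {}" "\<not> connected (with_proj G)" by blast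
  then show ?thesis
  proof cases
    case 1
    then show ?thesis by (subst bridge_depth.simps) simp
  next
    case 2
    then obtain u where u: "u \<in> pverts G" by blast
    have cn: "conn (parcs G) (pverts G)" using 2 connected_iff_conn[OF G] by simp
    have "component (parcs G) (pverts G) u = pverts G"
      using conn_subset_component[OF cn order_refl, of u] component_subset[of "parcs G" "pverts G" u]
        in_component_self[OF u, of "parcs G"] u by blast
    then have "pverts G \<in> components G" using u comps by auto
    moreover have "induced G (pverts G) = G"
      using pair_graph_facts(4)[OF G] by (simp add: induced_def Int_absorb2)
    ultimately show ?thesis using c by metis
  next
    case 3
    have fin: "finite (components G)" using comps pair_graph_facts(2)[OF G] by simp
    have ne: "components G \<noteq> {}" using comps 3 by simp
    have "bridge_depth G = Max ((\<lambda>C. bridge_depth (induced G C)) ` components G)"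
      using 3 pair_graph_facts(2)[OF G] by (subst bridge_depth.simps) simp
    also have "\<dots> \<le> c" using fin ne c by (subst Max_le_iff) auto
    finally show ?thesis .
  qed
qed

lemma conn_induced_component:
  assumes G: "pair_graph G" and C: "C \<in> components G"
  shows "conn (parcs (induced G C)) (pverts (induced G C))"
proof -
  obtain u where u: "u \<in> pverts G" "C = component (parcs G) (pverts G) u"
    using C components_eq[OF pair_graph_facts(1)[OF G]] by auto
  have "conn (parcs G) C" unfolding u(2) by (rule conn_component[OF pair_graph_facts(1)[OF G] u(1)])
  then have "conn (parcs (induced G C)) C" by (rule conn_cong[rotated]) (simp add: induced_def)
  moreover have "pverts (induced G C) = C"
    using component_subset[of "parcs G" "pverts G" u] u(2) by (auto simp: induced_def)
  ultimately show ?thesis by simp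
qed

text \<open>For hitting sets only the vertices of a necklace matter;
  \<open>bramble_hit_or_necklace\<close> is applied to this family.\<close>

definition necklace_family :: "'a pair_pre_digraph \<Rightarrow> nat \<Rightarrow> 'a set set" where
  "necklace_family G n = {\<Union>i<n. S i | S. necklace (pverts G) (parcs G) n S}"

lemma necklace_family_induced: "necklace_family (induced G W) n \<subseteq> necklace_family G n"
proof -
  have "pverts (induced G W) \<subseteq> pverts G" "parcs (induced G W) \<subseteq> parcs G"
    by (auto simp: induced_def)
  from necklace_mono[OF _ this] show ?thesis unfolding necklace_family_def by blast
qed

lemma necklace_family_subset: "X \<in> necklace_family G n \<Longrightarrow> X \<subseteq> pverts G"
  by (auto simp: necklace_family_def dest: necklaceD(2))

lemma hit_by_anti_mono: "hit_by k \<B> \<Longrightarrow> \<A> \<subseteq> \<B> \<Longrightarrow> hit_by k \<A>"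
  unfolding hit_by_def by (meson subsetD)

text \<open>The preimage of a necklace is a necklace of \<open>G\<close>, hence contains a vertex of
  the hitting set, whose representative lies on the given necklace. So the image of the hitting set
  works, and it is no larger.\<close>

lemma hit_by_contract_bridges:
  assumes G: "pair_graph G" and hit: "hit_by k (necklace_family G n)"
  shows "hit_by k (necklace_family (contract_bridges G) n)"
proof -
  obtain X where X: "finite X" "card X \<le> k" "\<forall>B\<in>necklace_family G n. B \<inter> X \<noteq> {}"
    using hit unfolding hit_by_def by metis
  define \<rho> where "\<rho> = contract_rep G {e. bridge G e}"
  have "B \<inter> \<rho> ` X \<noteq> {}" if B: "B \<in> necklace_family (contract_bridges G) n" for B
  proof -
    obtain S where S: "necklace (pverts (contract_bridges G)) (parcs (contract_bridges G)) n S"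
      "B = (\<Union>i<n. S i)" using B by (auto simp: necklace_family_def)
    have "(\<Union>i<n. contract_preimage G (S i)) \<in> necklace_family G n"
      using necklace_contract_preimage[OF G S(1)] by (auto simp: necklace_family_def)
    then have "(\<Union>i<n. contract_preimage G (S i)) \<inter> X \<noteq> {}" using X(3) by simp
    then obtain x i where "i < n" "x \<in> contract_preimage G (S i)" "x \<in> X" by auto
    then have "\<rho> x \<in> B \<inter> \<rho> ` X"
      by (auto simp: S(2) contract_preimage_def \<rho>_def)
    then show ?thesis by auto
  qed
  moreover have "card (\<rho> ` X) \<le> k" using card_image_le[OF X(1), of \<rho>] X(2) by simp
  ultimately show ?thesis unfolding hit_by_def using X(1) by (intro exI[of _ "\<rho> ` X"]) simp
qed

lemma necklace_family_empty_iff: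
  "necklace_family G n = {} \<longleftrightarrow> \<not> (\<exists>S. necklace (pverts G) (parcs G) n S)"
  by (simp add: necklace_family_def)

lemma contract_bridges_nonempty:
  "pair_graph G \<Longrightarrow> conn (parcs G) (pverts G) \<Longrightarrow> pverts (contract_bridges G) \<noteq> {}"
  using conn_nonempty[OF conn_contract_bridges] by blast

text \<open>Every level of the bridge-depth recursion pays for one vertex of the hitting set: in
  each contracted component a vertex of its image is deleted, and one vertex fewer suffices for the
  rest. Once no necklace is left, \<open>c\<close> takes over.\<close>

lemma bridge_depth_le_hit:
  assumes c: "\<And>G :: 'a pair_pre_digraph. pair_graph G \<Longrightarrow> necklace_family G n = {} \<Longrightarrow> bridge_depth G \<le> c"
  shows "pair_graph (G :: 'a pair_pre_digraph) \<Longrightarrow> hit_by k (necklace_family G n) \<Longrightarrow> bridge_depth G \<le> c + k"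
proof (induction k arbitrary: G)
  case 0
  then obtain X where "finite X" "card X \<le> 0" "\<forall>B\<in>necklace_family G n. B \<inter> X \<noteq> {}"
    unfolding hit_by_def by metis
  then have "necklace_family G n = {}" by auto
  then show ?case using c[OF 0(1)] by simp
next
  case (Suc k)
  show ?case
  proof (rule bridge_depth_le_components[OF Suc.prems(1)])
    fix C assume C: "C \<in> components G"
    define H where "H = induced G C"
    define M where "M = contract_bridges H"
    have H: "pair_graph H" unfolding H_def by (rule pair_graph_induced[OF Suc.prems(1)])
    have cH: "conn (parcs H) (pverts H)" unfolding H_def by (rule conn_induced_component[OF Suc.prems(1) C])
    have M: "pair_graph M" unfolding M_def by (rule pair_graph_contract_bridges[OF H])
    have "hit_by (Suc k) (necklace_family M n)"
      unfolding M_def H_def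
      by (rule hit_by_contract_bridges[OF H[unfolded H_def] hit_by_anti_mono[OF Suc.prems(2) necklace_family_induced]])
    then obtain X where X: "finite X" "card X \<le> Suc k" "\<forall>B\<in>necklace_family M n. B \<inter> X \<noteq> {}"
      unfolding hit_by_def by metis
    obtain w where w: "w \<in> pverts M" using contract_bridges_nonempty[OF H cH] unfolding M_def by auto
    \<comment> \<open>The recursion deletes a vertex in any case. If \<open>X\<close> misses
      \<open>M\<close>, then \<open>M\<close> has no necklace of \<open>n\<close> pieces and an
      arbitrary vertex will do.\<close>
    obtain v where v: "v \<in> pverts M" "X \<inter> pverts M = {} \<or> v \<in> X"
    proof (cases "X \<inter> pverts M = {}")
      case True
      with w show ?thesis using that by metis
    next
      case False
      then obtain v where "v \<in> X" "v \<in> pverts M" by auto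
      then show ?thesis using that by metis
    qed
    define D where "D = delete_verts M {v}"
    have D: "pair_graph D" unfolding D_def delete_verts_def by (rule pair_graph_induced[OF M])
    have DM: "necklace_family D n \<subseteq> necklace_family M n"
      unfolding D_def delete_verts_def by (rule necklace_family_induced)
    have vD: "v \<notin> pverts D" by (simp add: D_def delete_verts_def induced_def)
    have "bridge_depth D \<le> c + k"
      using v(2)
    proof
      assume XM: "X \<inter> pverts M = {}"
      have "necklace_family D n = {}"
      proof (rule ccontr)
        assume "necklace_family D n \<noteq> {}"
        then obtain B where "B \<in> necklace_family M n" using DM by auto
        then show False using X(3) necklace_family_subset[of B M n] XM by (auto simp: disjoint_iff)
      qed
      then show ?thesis using c[OF D] by simp
    next
      assume vX: "v \<in> X"
      have "B \<inter> (X - {v}) \<noteq> {}" if "B \<in> necklace_family D n" for B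
      proof -
        have "B \<inter> X \<noteq> {}" using X(3) DM that by auto
        moreover have "v \<notin> B" using necklace_family_subset[OF that] vD by auto
        ultimately show ?thesis by auto
      qed
      moreover have "card (X - {v}) \<le> k" using X vX by simp
      ultimately have "hit_by k (necklace_family D n)"
        unfolding hit_by_def using X(1) by (intro exI[of _ "X - {v}"]) simp
      then show ?thesis by (rule Suc.IH[OF D])
    qed
    then show "bridge_depth (induced G C) \<le> c + Suc k"
      using bridge_depth_connected_le[OF H cH, of v] v(1) unfolding D_def M_def H_def by simp
  qed
qed

text \<open>The bound starts at 0, as any vertex alone is a necklace of one piece. For one more
  piece it becomes \<open>1 + (c + K)\<close>: in a contracted component \<open>K\<close> vertices
  hit all shorter necklaces, and \<open>c\<close> bounds what remains after their deletion.\<close>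

theorem bridge_depth_bound:
  "\<exists>c. \<forall>G :: 'a pair_pre_digraph. pair_graph G \<longrightarrow> necklace_family G (Suc n) = {} \<longrightarrow> bridge_depth G \<le> c"
proof (induction n)
  case 0
  have "bridge_depth G \<le> 0" if "necklace_family G (Suc 0) = {}" for G :: "'a pair_pre_digraph"
  proof -
    have "pverts G = {}"
    proof (rule ccontr)
      assume "pverts G \<noteq> {}"
      then obtain u where "u \<in> pverts G" by auto
      then have "necklace (pverts G) (parcs G) (Suc 0) (\<lambda>_. {u})" by (simp add: necklace_def)
      with that show False by (auto simp: necklace_family_def)
    qed
    then show ?thesis by (subst bridge_depth.simps) simp
  qed
  then show ?case by blast
next
  case (Suc n)
  obtain c where c: "\<And>G :: 'a pair_pre_digraph. pair_graph G \<Longrightarrow> necklace_family G (Suc n) = {} \<Longrightarrow> bridge_depth G \<le> c"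
    using Suc.IH by blast
  obtain K where K: "\<And>V (E :: ('a \<times> 'a) set) \<B>. finite V \<Longrightarrow> E \<subseteq> V \<times> V \<Longrightarrow> sym E \<Longrightarrow> conn E V \<Longrightarrow>
     \<forall>B\<in>\<B>. conn E B \<and> B \<subseteq> V \<Longrightarrow> \<forall>B\<in>\<B>. \<forall>B'\<in>\<B>. B \<inter> B' \<noteq> {} \<Longrightarrow>
     hit_by K \<B> \<or> (\<exists>S. necklace V E (Suc (Suc n)) S)"
    using bramble_hit_or_necklace[where 'a = 'a, of "Suc (Suc n)"] by metis
  have "bridge_depth G \<le> 1 + (c + K)"
    if G: "pair_graph G" and none: "necklace_family G (Suc (Suc n)) = {}" for G :: "'a pair_pre_digraph"
  proof (rule bridge_depth_le_components[OF G])
    fix C assume C: "C \<in> components G"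
    define H where "H = induced G C"
    define M where "M = contract_bridges H"
    have H: "pair_graph H" unfolding H_def by (rule pair_graph_induced[OF G])
    have cH: "conn (parcs H) (pverts H)" unfolding H_def by (rule conn_induced_component[OF G C])
    have M: "pair_graph M" unfolding M_def by (rule pair_graph_contract_bridges[OF H])
    have cM: "conn (parcs M) (pverts M)" unfolding M_def by (rule conn_contract_bridges[OF H cH])
    have noneH: "necklace_family H (Suc (Suc n)) = {}"
      using necklace_family_induced[of G C "Suc (Suc n)"] none unfolding H_def by simp
    have noM: "\<not> (\<exists>S. necklace (pverts M) (parcs M) (Suc (Suc n)) S)"
      using necklace_contract_preimage[OF H] noneH unfolding M_def necklace_family_empty_iff by metis
    note Mf = pair_graph_facts[OF M]
    have "hit_by K (necklace_family M (Suc n)) \<or> (\<exists>S. necklace (pverts M) (parcs M) (Suc (Suc n)) S)"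
    proof (rule K[OF Mf(2,4,1) cM])
      show "\<forall>B\<in>necklace_family M (Suc n). conn (parcs M) B \<and> B \<subseteq> pverts M"
        using conn_necklace_Union[OF Mf(1)] necklace_family_subset[of _ M "Suc n"]
        by (auto simp: necklace_family_def)
      show "\<forall>B\<in>necklace_family M (Suc n). \<forall>B'\<in>necklace_family M (Suc n). B \<inter> B' \<noteq> {}"
      proof (intro ballI notI)
        fix B B' assume B: "B \<in> necklace_family M (Suc n)" "B' \<in> necklace_family M (Suc n)" "B \<inter> B' = {}"
        obtain S where S: "necklace (pverts M) (parcs M) (Suc n) S" "B = (\<Union>i<Suc n. S i)"
          using B(1) unfolding necklace_family_def by auto
        obtain T where T: "necklace (pverts M) (parcs M) (Suc n) T" "B' = (\<Union>i<Suc n. T i)"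
          using B(2) unfolding necklace_family_def by auto
        have "\<exists>R. necklace (pverts M) (parcs M) (Suc (Suc n)) R"
          by (rule disjoint_necklaces[OF Mf(2,1) cM _ _ S(1) T(1)])
            (use B(3) S(2) T(2) contract_bridges_bridgeless[OF H cH] in \<open>auto simp: M_def\<close>)
        with noM show False by blast
      qed
    qed
    with noM have hit: "hit_by K (necklace_family M (Suc n))" by blast
    \<comment> \<open>An arbitrary vertex. The recursion for \<open>H\<close> speaks only of
      \<open>M\<close> minus a vertex, so one deletion, the summand 1, is spent on entering the
      contracted graph.\<close>
    obtain v where v: "v \<in> pverts M" using contract_bridges_nonempty[OF H cH] unfolding M_def by auto
    have "hit_by K (necklace_family (delete_verts M {v}) (Suc n))"
      unfolding delete_verts_def by (rule hit_by_anti_mono[OF hit necklace_family_induced])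
    moreover have "pair_graph (delete_verts M {v})"
      unfolding delete_verts_def by (rule pair_graph_induced[OF M])
    ultimately have "bridge_depth (delete_verts M {v}) \<le> c + K"
      by (intro bridge_depth_le_hit[OF c])
    then show "bridge_depth (induced G C) \<le> 1 + (c + K)"
      using bridge_depth_connected_le[OF H cH, of v] v(1) unfolding M_def H_def by simp
  qed
  then show ?case by blast
qed


subsection \<open>Triangle paths\<close>

definition touches :: "('a \<times> 'a) set \<Rightarrow> 'a set \<Rightarrow> 'a set \<Rightarrow> bool" where
  "touches E A B \<longleftrightarrow> (\<exists>a\<in>A. \<exists>b\<in>B. (a, b) \<in> E)"

lemma touches_sym: "sym E \<Longrightarrow> touches E A B \<Longrightarrow> touches E B A"
  unfolding touches_def by (meson symD)

lemma touchesI: "(a, b) \<in> E \<Longrightarrow> a \<in> A \<Longrightarrow> b \<in> B \<Longrightarrow> touches E A B"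
  unfolding touches_def by blast

lemma conn_split_touches:
  assumes "sym E" "finite S" "conn E S" "a \<in> S" "b \<in> S" "a \<noteq> b"
  obtains A B where "a \<in> A" "b \<in> B" "conn E A" "conn E B" "A \<inter> B = {}" "A \<union> B = S" "touches E A B"
proof -
  obtain A B where AB: "a \<in> A" "b \<in> B" "conn E A" "conn E B" "A \<inter> B = {}" "A \<union> B = S"
    using conn_split[OF assms] by metis
  have "A \<subseteq> S" "A \<noteq> {}" "A \<noteq> S" using AB by auto
  from conn_cut[OF assms(3) this] obtain x y where "x \<in> A" "y \<in> S - A" "(x, y) \<in> E" by metis
  then have "touches E A B" using AB by (intro touchesI[of x y]) auto
  with AB show ?thesis using that by metis
qed

text \<open>\<open>p\<close> and \<open>q\<close> are ports where the edges to the previous and to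
  the next triangle end, so they have to lie in different corners; the third corner \<open>W\<close>
  becomes the apex.\<close>

definition triangle_model ::
    "('a \<times> 'a) set \<Rightarrow> 'a set \<Rightarrow> 'a \<Rightarrow> 'a \<Rightarrow> 'a set \<Rightarrow> 'a set \<Rightarrow> 'a set \<Rightarrow> bool" where
  "triangle_model E Z p q U V W \<longleftrightarrow> conn E U \<and> conn E V \<and> conn E W \<and> U \<union> V \<union> W \<subseteq> Z \<and>
     U \<inter> V = {} \<and> U \<inter> W = {} \<and> V \<inter> W = {} \<and> touches E U V \<and> touches E U W \<and> touches E V W \<and> p \<in> U \<and> q \<in> V"

text \<open>The two edges differ at one end, say in \<open>B\<close>. Splitting \<open>B\<close>
  between these two ends gives halves that touch each other and are both touched by
  \<open>A\<close>; the half containing \<open>q\<close> is the second corner and the other half the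
  apex. If the ends in \<open>B\<close> coincide, \<open>A\<close> is split instead.\<close>

lemma double_link_triangle:
  assumes E: "sym E" and fin: "finite A" "finite B" and c: "conn E A" "conn E B"
    and dis: "A \<inter> B = {}" and dl: "double_link E A B" and pq: "p \<in> A" "q \<in> B"
  shows "\<exists>U V W. triangle_model E (A \<union> B) p q U V W"
proof (rule double_linkE[OF dl])
  fix u v x y assume *: "(u, v) \<in> E" "u \<in> A" "v \<in> B" "(x, y) \<in> E" "x \<in> A" "y \<in> B" "u \<noteq> x \<or> v \<noteq> y"
  show ?thesis
  proof (cases "v = y")
    case False
    obtain X Y where XY: "v \<in> X" "y \<in> Y" "conn E X" "conn E Y" "X \<inter> Y = {}" "X \<union> Y = B" "touches E X Y"
      using conn_split_touches[OF E fin(2) c(2) *(3,6) False] .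
    have l: "touches E A X" "touches E A Y" "touches E Y X"
      using touchesI[OF *(1,2) XY(1)] touchesI[OF *(4,5) XY(2)] touches_sym[OF E XY(7)] by auto
    have d: "A \<inter> X = {}" "A \<inter> Y = {}" using dis XY(6) by auto
    show ?thesis
    proof (cases "q \<in> X")
      case True
      then show ?thesis
        using XY l d c pq by (intro exI[of _ A] exI[of _ X] exI[of _ Y]) (auto simp: triangle_model_def)
    next
      case False
      then have "q \<in> Y" using pq XY by auto
      then show ?thesis
        using XY l d c pq by (intro exI[of _ A] exI[of _ Y] exI[of _ X]) (auto simp: triangle_model_def)
    qed
  next
    case True
    with * have ne: "u \<noteq> x" by simp
    obtain X Y where XY: "u \<in> X" "x \<in> Y" "conn E X" "conn E Y" "X \<inter> Y = {}" "X \<union> Y = A" "touches E X Y"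
      using conn_split_touches[OF E fin(1) c(1) *(2,5) ne] .
    have l: "touches E X B" "touches E Y B" "touches E B X" "touches E B Y" "touches E Y X"
      using touchesI[OF *(1) XY(1) *(3)] touchesI[OF *(4) XY(2) *(6)] touches_sym[OF E] XY(7) by auto
    have d: "X \<inter> B = {}" "Y \<inter> B = {}" using dis XY(6) by auto
    show ?thesis
    proof (cases "p \<in> X")
      case True
      then show ?thesis
        using XY l d c pq by (intro exI[of _ X] exI[of _ B] exI[of _ Y]) (auto simp: triangle_model_def)
    next
      case False
      then have "p \<in> Y" using pq XY by auto
      then show ?thesis
        using XY l d c pq by (intro exI[of _ Y] exI[of _ B] exI[of _ X]) (auto simp: triangle_model_def)
    qed
  qed
qed

text \<open>
  The vertices \<open>(i, 0)\<close>, \<open>(i, 1)\<close>, \<open>(i, 2)\<close> form the \<open>i\<close>-th triangle, and \<open>(i, 1)\<close> is joined to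
  \<open>(i + 1, 0)\<close>.
\<close>

definition triangle_adj :: "nat \<times> nat \<Rightarrow> nat \<times> nat \<Rightarrow> bool" where
  "triangle_adj a b \<longleftrightarrow> fst a = fst b \<and> snd a \<noteq> snd b \<or>
     fst b = Suc (fst a) \<and> snd a = 1 \<and> snd b = 0 \<or> fst a = Suc (fst b) \<and> snd b = 1 \<and> snd a = 0"

lemma triangle_adj_sym: "triangle_adj a b \<Longrightarrow> triangle_adj b a"
  by (auto simp: triangle_adj_def)

definition triangle_index :: "nat \<Rightarrow> (nat \<times> nat) set" where
  "triangle_index t = {..<t} \<times> {0, 1, 2}"

text \<open>The labelling \<open>x\<close> puts the graph on the vertex type of the given family, as
  minor-closedness only speaks of graphs over that type.\<close>

definition triangle_path :: "nat \<Rightarrow> (nat \<times> nat \<Rightarrow> 'a) \<Rightarrow> 'a pair_pre_digraph" where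
  "triangle_path t x = \<lparr> pverts = x ` triangle_index t,
     parcs = {(x a, x b) | a b. a \<in> triangle_index t \<and> b \<in> triangle_index t \<and> triangle_adj a b} \<rparr>"

text \<open>Pieces \<open>2 * i\<close> and \<open>2 * i + 1\<close> form the triangle
  \<open>i\<close>. Between pieces \<open>2 * i + 1\<close> and \<open>2 * i + 2\<close> one edge is
  enough; its ends are prescribed as ports before the triangles are built, so that it joins the
  right corners.\<close>

lemma necklace_triangle_path:
  assumes V: "finite V" and E: "sym E" and S: "necklace V E (2 * t) S"
  shows "\<exists>\<beta>. (\<forall>a\<in>triangle_index t. conn E (\<beta> a) \<and> \<beta> a \<subseteq> V) \<and>
    (\<forall>a\<in>triangle_index t. \<forall>b\<in>triangle_index t. a \<noteq> b \<longrightarrow> \<beta> a \<inter> \<beta> b = {}) \<and>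
    (\<forall>a\<in>triangle_index t. \<forall>b\<in>triangle_index t. triangle_adj a b \<longrightarrow> touches E (\<beta> a) (\<beta> b))"
proof -
  have "\<exists>q p. Suc i < t \<longrightarrow> (q, p) \<in> E \<and> q \<in> S (2 * i + 1) \<and> p \<in> S (2 * i + 2)" for i
  proof (cases "Suc i < t")
    case True
    then have "double_link E (S (2 * i + 1)) (S (Suc (2 * i + 1)))" by (intro necklaceD(4)[OF S]) simp
    then show ?thesis by (rule double_linkE) auto
  qed simp
  then obtain e f where ef: "\<And>i. Suc i < t \<Longrightarrow> (e i, f i) \<in> E \<and> e i \<in> S (2 * i + 1) \<and> f i \<in> S (2 * i + 2)"
    by metis
  \<comment> \<open>The first triangle has no predecessor and the last no successor, so the ports
    there are arbitrary vertices of the right pieces.\<close>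
  define p where "p i = (if i = 0 then SOME z. z \<in> S 0 else f (i - 1))" for i
  define q where "q i = (if Suc i < t then e i else SOME z. z \<in> S (2 * i + 1))" for i
  have some: "(SOME z. z \<in> S i) \<in> S i" if "i < 2 * t" for i
    using conn_nonempty[OF necklaceD(1)[OF S that]] by (simp add: some_in_eq)
  have p: "p i \<in> S (2 * i)" if "i < t" for i
    using ef[of "i - 1"] some[of 0] that by (cases i) (auto simp: p_def)
  have q: "q i \<in> S (2 * i + 1)" if "i < t" for i
    using ef[of i] some[of "2 * i + 1"] that by (auto simp: q_def)
  have qp: "(q i, p (Suc i)) \<in> E" if "Suc i < t" for i
    using ef that by (simp add: p_def q_def)
  have "\<exists>U W X. i < t \<longrightarrow> triangle_model E (S (2 * i) \<union> S (2 * i + 1)) (p i) (q i) U W X" for i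
  proof (cases "i < t")
    case True
    have "finite (S j)" if "j < 2 * t" for j using necklaceD(2)[OF S that] V finite_subset by metis
    then show ?thesis
      using double_link_triangle[OF E _ _ necklaceD(1)[OF S, of "2 * i"] necklaceD(1)[OF S, of "2 * i + 1"]
          necklaceD(3)[OF S, of "2 * i" "2 * i + 1"] _ p[OF True] q[OF True]]
        necklaceD(4)[OF S, of "2 * i"] True by simp
  qed simp
  then obtain U W X where T: "\<And>i. i < t \<Longrightarrow> triangle_model E (S (2 * i) \<union> S (2 * i + 1)) (p i) (q i) (U i) (W i) (X i)"
    by metis
  define \<beta> where "\<beta> a = (if snd a = 0 then U (fst a) else if snd a = 1 then W (fst a) else X (fst a))" for a :: "nat \<times> nat"
  have sub: "\<beta> a \<subseteq> S (2 * fst a) \<union> S (2 * fst a + 1)" if "a \<in> triangle_index t" for a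
    using T[of "fst a"] that by (auto simp: \<beta>_def triangle_model_def triangle_index_def)
  have "conn E (\<beta> a) \<and> \<beta> a \<subseteq> V" if a: "a \<in> triangle_index t" for a
  proof -
    have "fst a < t" using a by (auto simp: triangle_index_def)
    then have "S (2 * fst a) \<union> S (2 * fst a + 1) \<subseteq> V"
      using necklaceD(2)[OF S, of "2 * fst a"] necklaceD(2)[OF S, of "2 * fst a + 1"] by simp
    moreover have "conn E (\<beta> a)"
      using T[of "fst a"] a by (auto simp: \<beta>_def triangle_model_def triangle_index_def)
    ultimately show ?thesis using sub[OF a] by blast
  qed
  moreover have "\<beta> a \<inter> \<beta> b = {}" if ab: "a \<in> triangle_index t" "b \<in> triangle_index t" "a \<noteq> b" for a b
  proof (cases "fst a = fst b")
    case True
    then have "snd a \<noteq> snd b" using ab(3) by (simp add: prod_eq_iff)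
    then show ?thesis
      using T[of "fst a"] True ab by (auto simp: \<beta>_def triangle_model_def triangle_index_def)
  next
    case False
    have l: "fst a < t" "fst b < t" using ab by (auto simp: triangle_index_def)
    have "S i \<inter> S j = {}" if "i \<in> {2 * fst a, 2 * fst a + 1}" "j \<in> {2 * fst b, 2 * fst b + 1}" for i j
      by (rule necklaceD(3)[OF S]) (use that l False in \<open>auto; presburger\<close>)+
    then have "(S (2 * fst a) \<union> S (2 * fst a + 1)) \<inter> (S (2 * fst b) \<union> S (2 * fst b + 1)) = {}"
      by (simp add: Int_Un_distrib Int_Un_distrib2)
    then show ?thesis using sub[OF ab(1)] sub[OF ab(2)] by (metis Int_mono subset_empty)
  qed
  moreover have "touches E (\<beta> a) (\<beta> b)"
    if ab: "a \<in> triangle_index t" "b \<in> triangle_index t" "triangle_adj a b" for a b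
  proof -
    have l: "fst a < t" "fst b < t" "snd a \<in> {0, 1, 2}" "snd b \<in> {0, 1, 2}"
      using ab by (auto simp: triangle_index_def)
    have step: "touches E (W i) (U (Suc i))" if "Suc i < t" for i
      using touchesI[OF qp[OF that], of "W i" "U (Suc i)"] T[of i] T[of "Suc i"] that
      by (simp add: triangle_model_def)
    from ab(3) consider "fst a = fst b" "snd a \<noteq> snd b"
      | "fst b = Suc (fst a)" "snd a = 1" "snd b = 0" | "fst a = Suc (fst b)" "snd b = 1" "snd a = 0"
      unfolding triangle_adj_def by metis
    then show ?thesis
    proof cases
      case 1
      have "touches E (U i) (W i)" "touches E (U i) (X i)" "touches E (W i) (X i)"
        "touches E (W i) (U i)" "touches E (X i) (U i)" "touches E (X i) (W i)" if "i < t" for i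
        using T[OF that] touches_sym[OF E] by (auto simp: triangle_model_def)
      then show ?thesis using 1 l by (auto simp: \<beta>_def)
    next
      case 2
      then show ?thesis using step[of "fst a"] l by (simp add: \<beta>_def)
    next
      case 3
      then show ?thesis using touches_sym[OF E step[of "fst b"]] l by (simp add: \<beta>_def)
    qed
  qed
  ultimately show ?thesis by (intro exI[of _ \<beta>]) blast
qed


subsection \<open>Minimal blocking sets of triangle paths\<close>

lemma finite_independent_sets: "finite (pverts G) \<Longrightarrow> finite {S. independent_set G S}"
  by (rule finite_subset[of _ "Pow (pverts G)"]) (auto simp: independent_set_def)

lemma independence_number_ge:
  "finite (pverts G) \<Longrightarrow> independent_set G S \<Longrightarrow> card S \<le> independence_number G"
  unfolding independence_number_def using finite_independent_sets by (intro Max_ge) auto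

lemma independence_number_le:
  assumes "finite (pverts G)" "\<And>S. independent_set G S \<Longrightarrow> card S \<le> k"
  shows "independence_number G \<le> k"
proof -
  have "independent_set G {}" by (simp add: independent_set_def)
  then show ?thesis
    unfolding independence_number_def
    using finite_independent_sets[OF assms(1)] assms(2) by (subst Max_le_iff) auto
qed

lemma independent_set_delete_verts:
  "independent_set (delete_verts G Y) S \<longleftrightarrow> independent_set G S \<and> S \<inter> Y = {}"
proof -
  have pv: "pverts (delete_verts G Y) = pverts G - Y" by (auto simp: delete_verts_def induced_def)
  show ?thesis
  proof (cases "S \<subseteq> pverts G - Y")
    case True
    then have "(u, v) \<in> parcs (delete_verts G Y) \<longleftrightarrow> (u, v) \<in> parcs G" if "u \<in> S" "v \<in> S" for u v
      using that by (auto simp: delete_verts_def induced_def)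
    then show ?thesis unfolding independent_set_def pv using True by auto
  next
    case False
    then show ?thesis unfolding independent_set_def pv by auto
  qed
qed

text \<open>A proper subset of \<open>Y\<close> omits some \<open>y\<close>, and a maximum
  independent set avoiding \<open>Y - {y}\<close> avoids that subset too; so it suffices to test the
  subsets with one element removed.\<close>

lemma minimal_blocking_setI:
  assumes fin: "finite (pverts G)" and Y: "Y \<subseteq> pverts G"
    and block: "independence_number (delete_verts G Y) < independence_number G"
    and minimal: "\<And>y. y \<in> Y \<Longrightarrow>
      \<exists>S. independent_set G S \<and> S \<inter> (Y - {y}) = {} \<and> independence_number G \<le> card S"
  shows "minimal_blocking_set G Y"
  unfolding minimal_blocking_set_def
proof (intro conjI allI impI)
  show "blocking_set G Y" using Y block by (simp add: blocking_set_def)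
  fix Z assume Z: "Z \<subset> Y"
  then obtain y where y: "y \<in> Y" "y \<notin> Z" by auto
  obtain S where S: "independent_set G S" "S \<inter> (Y - {y}) = {}" "independence_number G \<le> card S"
    using minimal[OF y(1)] by metis
  have "S \<inter> Z = {}" using S(2) Z y by auto
  then have "independent_set (delete_verts G Z) S" using S(1) by (simp add: independent_set_delete_verts)
  moreover have "finite (pverts (delete_verts G Z))" using fin by (simp add: delete_verts_def induced_def)
  ultimately have "card S \<le> independence_number (delete_verts G Z)" by (intro independence_number_ge)
  then show "\<not> blocking_set G Z" using S(3) by (simp add: blocking_set_def)
qed

lemma finite_triangle_index: "finite (triangle_index t)"
  by (simp add: triangle_index_def)

lemma parcs_triangle_path_iff:
  "(u, v) \<in> parcs (triangle_path t x) \<longleftrightarrow>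
    (\<exists>a b. u = x a \<and> v = x b \<and> a \<in> triangle_index t \<and> b \<in> triangle_index t \<and> triangle_adj a b)"
  by (simp add: triangle_path_def)

lemma pair_graph_triangle_path:
  assumes x: "inj_on x (triangle_index t)"
  shows "pair_graph (triangle_path t x)"
proof -
  let ?I = "triangle_index t"
  have "parcs (triangle_path t x) \<subseteq> x ` ?I \<times> x ` ?I" by (auto simp: triangle_path_def)
  then have "finite (parcs (triangle_path t x))"
    by (rule finite_subset) (simp add: finite_triangle_index)
  moreover have "sym (parcs (triangle_path t x))"
    unfolding sym_def parcs_triangle_path_iff using triangle_adj_sym by metis
  moreover have "(y, y) \<notin> parcs (triangle_path t x)" for y
    unfolding parcs_triangle_path_iff triangle_adj_def using inj_onD[OF x] by (metis n_not_Suc_n)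
  ultimately show ?thesis
    by unfold_locales (auto simp: triangle_path_def finite_triangle_index symmetric_def)
qed

lemma independent_set_triangle_path:
  assumes x: "inj_on x (triangle_index t)" and T: "T \<subseteq> triangle_index t"
  shows "independent_set (triangle_path t x) (x ` T) \<longleftrightarrow> (\<forall>a\<in>T. \<forall>b\<in>T. \<not> triangle_adj a b)"
proof -
  have "(x a, x b) \<in> parcs (triangle_path t x) \<longleftrightarrow> triangle_adj a b" if "a \<in> T" "b \<in> T" for a b
  proof -
    have "a \<in> triangle_index t" "b \<in> triangle_index t" using T that by auto
    with inj_onD[OF x] show ?thesis unfolding parcs_triangle_path_iff by metis
  qed
  moreover have "x ` T \<subseteq> pverts (triangle_path t x)" using T by (auto simp: triangle_path_def)
  ultimately show ?thesis by (auto simp: independent_set_def)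
qed

lemma independent_set_triangle_pathE:
  assumes x: "inj_on x (triangle_index t)" and S: "independent_set (triangle_path t x) S"
  obtains T where "T \<subseteq> triangle_index t" "S = x ` T" "card S = card T"
    "\<And>a b. a \<in> T \<Longrightarrow> b \<in> T \<Longrightarrow> \<not> triangle_adj a b"
proof -
  have "S \<subseteq> x ` triangle_index t" using S by (simp add: independent_set_def triangle_path_def)
  then obtain T where T: "T \<subseteq> triangle_index t" "S = x ` T" by (auto simp: subset_image_iff)
  moreover have "card S = card T" using T x by (simp add: card_image inj_on_subset)
  moreover have "\<not> triangle_adj a b" if "a \<in> T" "b \<in> T" for a b
    using independent_set_triangle_path[OF x T(1)] S T(2) that by simp
  ultimately show ?thesis using that by metis
qed

text \<open>One vertex is taken from each triangle. Edges between triangles only join corner 1 to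
  corner 0 of the next one, so the selection is independent as soon as a 1 is never followed by a
  0.\<close>

lemma independent_selection:
  assumes x: "inj_on x (triangle_index t)"
    and c: "\<And>j. c j \<in> {0, 1, 2}" "\<And>j. \<not> (c j = 1 \<and> c (Suc j) = 0)"
  shows "independent_set (triangle_path t x) ((\<lambda>j. x (j, c j)) ` {..<t})"
    and "card ((\<lambda>j. x (j, c j)) ` {..<t}) = t"
proof -
  define T where "T = (\<lambda>j. (j, c j)) ` {..<t}"
  have "(j, c j) \<in> triangle_index t" if "j < t" for j
    using c(1)[of j] that by (simp add: triangle_index_def)
  then have T: "T \<subseteq> triangle_index t" by (auto simp: T_def)
  have im: "(\<lambda>j. x (j, c j)) ` {..<t} = x ` T" by (simp add: T_def image_image)
  have "\<not> triangle_adj a b" if ab: "a \<in> T" "b \<in> T" for a b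
  proof -
    obtain j k where "a = (j, c j)" "b = (k, c k)" using ab by (auto simp: T_def)
    then show ?thesis using c(2)[of j] c(2)[of k] by (auto simp: triangle_adj_def)
  qed
  then show "independent_set (triangle_path t x) ((\<lambda>j. x (j, c j)) ` {..<t})"
    unfolding im independent_set_triangle_path[OF x T] by simp
  have "card (x ` T) = card T" using T x by (simp add: card_image inj_on_subset)
  also have "card T = t" unfolding T_def by (subst card_image) (auto simp: inj_on_def)
  finally show "card ((\<lambda>j. x (j, c j)) ` {..<t}) = t" unfolding im .
qed

text \<open>An independent set has at most one vertex in each triangle, and taking corner 0
  throughout attains this.\<close>

lemma independence_number_triangle_path:
  assumes x: "inj_on x (triangle_index t)"
  shows "independence_number (triangle_path t x) = t"
proof (rule antisym)
  have fin: "finite (pverts (triangle_path t x))" by (simp add: triangle_path_def finite_triangle_index)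
  show "independence_number (triangle_path t x) \<le> t"
  proof (rule independence_number_le[OF fin])
    fix S assume "independent_set (triangle_path t x) S"
    then obtain T where T: "T \<subseteq> triangle_index t" "S = x ` T" "card S = card T"
      "\<And>a b. a \<in> T \<Longrightarrow> b \<in> T \<Longrightarrow> \<not> triangle_adj a b" using independent_set_triangle_pathE[OF x] by metis
    have "inj_on fst T"
    proof (rule inj_onI)
      fix a b assume "a \<in> T" "b \<in> T" "fst a = fst b"
      with T(4)[of a b] show "a = b" by (auto simp: triangle_adj_def prod_eq_iff)
    qed
    moreover have "fst ` T \<subseteq> {..<t}" using T(1) by (auto simp: triangle_index_def)
    ultimately have "card T \<le> card {..<t}" by (intro card_inj_on_le) auto
    then show "card S \<le> t" using T(3) by simp
  qed
  show "t \<le> independence_number (triangle_path t x)"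
    using independence_number_ge[OF fin independent_selection(1)[OF x, of "\<lambda>_. 0"]]
      independent_selection(2)[OF x, of "\<lambda>_. 0"] by simp
qed

text \<open>
  Removing all apexes \<open>(i, 2)\<close> and both ends leaves a path on \<open>2 (t - 1)\<close> vertices, which has a
  perfect matching.
\<close>

theorem minimal_blocking_set_triangle_path:
  assumes x: "inj_on x (triangle_index t)" and t: "0 < t"
  defines "J \<equiv> {..<t} \<times> {2} \<union> {(0, 0), (t - 1, 1)}"
  shows "minimal_blocking_set (triangle_path t x) (x ` J)"
proof (rule minimal_blocking_setI)
  let ?H = "triangle_path t x"
  have J: "J \<subseteq> triangle_index t" using t by (auto simp: J_def triangle_index_def)
  show fin: "finite (pverts ?H)" by (simp add: triangle_path_def finite_triangle_index)
  show "x ` J \<subseteq> pverts ?H" using J by (auto simp: triangle_path_def)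
  note \<alpha> = independence_number_triangle_path[OF x]
  have "independence_number (delete_verts ?H (x ` J)) \<le> t - 1"
  proof (rule independence_number_le)
    show "finite (pverts (delete_verts ?H (x ` J)))" using fin by (simp add: delete_verts_def induced_def)
    fix S assume "independent_set (delete_verts ?H (x ` J)) S"
    then have S: "independent_set ?H S" "S \<inter> x ` J = {}" by (auto simp: independent_set_delete_verts)
    obtain T where T: "T \<subseteq> triangle_index t" "S = x ` T" "card S = card T"
      "\<And>a b. a \<in> T \<Longrightarrow> b \<in> T \<Longrightarrow> \<not> triangle_adj a b" using independent_set_triangle_pathE[OF x S(1)] by metis
    have TJ: "a \<notin> J" if "a \<in> T" for a using S(2) T(2) that by auto
    have cases: "snd a = 0 \<and> 0 < fst a \<and> fst a < t \<or> snd a = 1 \<and> fst a < t - 1" if a: "a \<in> T" for a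
    proof -
      have "fst a < t" "snd a \<in> {0, 1, 2}" using a T(1) by (auto simp: triangle_index_def)
      moreover have "a \<notin> {..<t} \<times> {2}" "a \<noteq> (0, 0)" "a \<noteq> (t - 1, 1)" using TJ[OF a] by (auto simp: J_def)
      ultimately show ?thesis by (cases a) auto
    qed
    \<comment> \<open>\<open>f\<close> numbers the edges of the perfect matching:
      \<open>(i, 1)\<close> and \<open>(i + 1, 0)\<close> both belong to edge \<open>i\<close>. An
      independent set contains at most one of them.\<close>
    define f where "f a = (if snd a = 0 then fst a - 1 else fst a)" for a :: "nat \<times> nat"
    have "inj_on f T"
    proof (rule inj_onI)
      fix a b assume ab: "a \<in> T" "b \<in> T" "f a = f b"
      show "a = b"
        using cases[OF ab(1)] cases[OF ab(2)] T(4)[OF ab(1,2)] ab(3)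
        by (auto simp: f_def triangle_adj_def prod_eq_iff)
    qed
    moreover have "f ` T \<subseteq> {..<t - 1}" using cases by (fastforce simp: f_def)
    ultimately have "card T \<le> card {..<t - 1}" by (intro card_inj_on_le) auto
    then show "card S \<le> t - 1" using T(3) by simp
  qed
  then show "independence_number (delete_verts ?H (x ` J)) < independence_number ?H"
    using t unfolding \<alpha> by simp
  fix y assume "y \<in> x ` J"
  then obtain a where a: "a \<in> J" "y = x a" by (elim imageE) metis
  \<comment> \<open>A maximum independent set may use \<open>a\<close> but nothing else of
    \<open>J\<close>. For an apex \<open>(i, 2)\<close> take corner 1 before \<open>i\<close>, the
    apex at \<open>i\<close> and corner 0 after it: this avoids both ends and never has a 1 followed
    by a 0. For the ends the constant selections 0 and 1 work.\<close>
  have "\<exists>c. (\<forall>j. c j \<in> {0, 1, 2}) \<and> (\<forall>j. \<not> (c j = 1 \<and> c (Suc j) = 0)) \<and>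
      (\<forall>j<t. (j, c j) \<in> J \<longrightarrow> (j, c j) = a)"
  proof -
    consider i where "a = (i, 2)" "i < t" | "a = (0, 0)" | "a = (t - 1, 1)"
      using a(1) unfolding J_def by blast
    then show ?thesis
    proof cases
      case 1
      then show ?thesis
        by (intro exI[of _ "\<lambda>j. if j < i then 1 else if j = i then 2 else 0"]) (auto simp: J_def)
    next
      case 2
      then show ?thesis by (intro exI[of _ "\<lambda>_. 0"]) (auto simp: J_def)
    next
      case 3
      then show ?thesis by (intro exI[of _ "\<lambda>_. 1"]) (auto simp: J_def)
    qed
  qed
  then obtain c where c: "\<And>j. c j \<in> {0, 1, 2}" "\<And>j. \<not> (c j = 1 \<and> c (Suc j) = 0)"
    "\<And>j. j < t \<Longrightarrow> (j, c j) \<in> J \<Longrightarrow> (j, c j) = a" by metis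
  have "(\<lambda>j. x (j, c j)) ` {..<t} \<inter> (x ` J - {y}) = {}"
  proof (rule ccontr)
    assume "\<not> ?thesis"
    then obtain j b where jb: "j < t" "b \<in> J" "x (j, c j) = x b" "x b \<noteq> y" by auto
    have "(j, c j) \<in> triangle_index t" using jb c(1)[of j] by (simp add: triangle_index_def)
    then have "(j, c j) = b" using x jb J by (meson inj_onD subsetD)
    then show False using c(3)[OF jb(1)] jb a by auto
  qed
  moreover have "independent_set ?H ((\<lambda>j. x (j, c j)) ` {..<t})" "card ((\<lambda>j. x (j, c j)) ` {..<t}) = t"
    by (rule independent_selection[OF x, of c]; fact c)+
  ultimately show "\<exists>S. independent_set ?H S \<and> S \<inter> (x ` J - {y}) = {} \<and> independence_number ?H \<le> card S"
    unfolding \<alpha> by (metis order_refl)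
qed

lemma minorI: "minor_model H G \<phi> \<Longrightarrow> minor H G"
  unfolding minor_def by blast

text \<open>Each index is labelled by a vertex of its own branch set. The branch sets are disjoint,
  so the labelling is injective, and \<open>\<phi>\<close> can recover the index from the
  label.\<close>

lemma minor_triangle_path:
  fixes G :: "'a pair_pre_digraph"
  assumes G: "pair_graph G" and S: "necklace (pverts G) (parcs G) (2 * t) S"
  shows "\<exists>x :: nat \<times> nat \<Rightarrow> 'a. inj_on x (triangle_index t) \<and> minor (triangle_path t x) G"
proof -
  let ?I = "triangle_index t" and ?V = "pverts G" and ?E = "parcs G"
  note Gf = pair_graph_facts[OF G]
  obtain \<beta> where \<beta>: "\<And>a. a \<in> ?I \<Longrightarrow> conn ?E (\<beta> a) \<and> \<beta> a \<subseteq> ?V"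
    "\<And>a b. a \<in> ?I \<Longrightarrow> b \<in> ?I \<Longrightarrow> a \<noteq> b \<Longrightarrow> \<beta> a \<inter> \<beta> b = {}"
    "\<And>a b. a \<in> ?I \<Longrightarrow> b \<in> ?I \<Longrightarrow> triangle_adj a b \<Longrightarrow> touches ?E (\<beta> a) (\<beta> b)"
    using necklace_triangle_path[OF Gf(2,1) S] by metis
  define x where "x a = (SOME z. z \<in> \<beta> a)" for a
  have x: "x a \<in> \<beta> a" if "a \<in> ?I" for a
    unfolding x_def using conn_nonempty[of ?E "\<beta> a"] \<beta>(1)[OF that] by (simp add: some_in_eq)
  have inj: "inj_on x ?I"
  proof (rule inj_onI)
    fix a b assume ab: "a \<in> ?I" "b \<in> ?I" "x a = x b"
    then have "x a \<in> \<beta> a \<inter> \<beta> b" using x[of a] x[of b] by auto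
    then show "a = b" using \<beta>(2)[OF ab(1,2)] by auto
  qed
  define \<phi> where "\<phi> y = \<beta> (inv_into ?I x y)" for y
  have \<phi>: "\<phi> (x a) = \<beta> a" if "a \<in> ?I" for a using inj that by (simp add: \<phi>_def)
  have "minor_model (triangle_path t x) G \<phi>"
    unfolding minor_model_def
  proof (intro conjI ballI impI)
    fix y assume "y \<in> pverts (triangle_path t x)"
    then obtain a where a: "a \<in> ?I" "y = x a" by (auto simp: triangle_path_def)
    show "\<phi> y \<subseteq> ?V" using \<beta>(1)[OF a(1)] \<phi> a by simp
    have "pverts (induced G (\<beta> a)) = \<beta> a" using \<beta>(1)[OF a(1)] by (auto simp: induced_def)
    moreover have "conn (parcs (induced G (\<beta> a))) (\<beta> a)"
      by (rule conn_cong[of _ ?E]) (use \<beta>(1)[OF a(1)] in \<open>auto simp: induced_def\<close>)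
    ultimately show "connected (with_proj (induced G (\<phi> y)))"
      using connected_iff_conn[OF pair_graph_induced[OF G]] \<phi> a by simp
  next
    fix y z assume "y \<in> pverts (triangle_path t x)" "z \<in> pverts (triangle_path t x)" "y \<noteq> z"
    then obtain a b where "a \<in> ?I" "y = x a" "b \<in> ?I" "z = x b" "a \<noteq> b" by (auto simp: triangle_path_def)
    then show "\<phi> y \<inter> \<phi> z = {}" using \<beta>(2) \<phi> by simp
  next
    fix e assume "e \<in> parcs (triangle_path t x)"
    then obtain a b where ab: "a \<in> ?I" "b \<in> ?I" "triangle_adj a b" "e = (x a, x b)"
      by (auto simp: triangle_path_def)
    then show "case e of (y, z) \<Rightarrow> \<exists>u\<in>\<phi> y. \<exists>v\<in>\<phi> z. (u, v) \<in> ?E"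
      using \<beta>(3)[OF ab(1-3)] \<phi> by (simp add: touches_def)
  qed
  then have "minor (triangle_path t x) G" by (rule minorI)
  with inj show ?thesis by blast
qed

theorem theorem23:
  fixes F :: "'a pair_pre_digraph set"
  assumes "\<And>G. G \<in> F \<Longrightarrow> pair_graph G"
    and "minor_closed F"
    and "unbounded_bridge_depth F"
  shows "\<forall>b. \<exists>G\<in>F. \<exists>Y. minimal_blocking_set G Y \<and> card Y > b"
proof
  fix b :: nat
  \<comment> \<open>The \<open>t\<close> apexes alone make the blocking set larger than
    \<open>b\<close>.\<close>
  define t where "t = Suc b"
  have t: "2 * t = Suc (2 * t - 1)" by (simp add: t_def)
  obtain c where c: "\<And>G :: 'a pair_pre_digraph. pair_graph G \<Longrightarrow> necklace_family G (2 * t) = {} \<Longrightarrow>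
      bridge_depth G \<le> c"
    using bridge_depth_bound[of "2 * t - 1"] unfolding t[symmetric] by metis
  obtain G where G: "G \<in> F" "bridge_depth G > c"
    using assms(3) unfolding unbounded_bridge_depth_def by metis
  have pG: "pair_graph G" by (rule assms(1)[OF G(1)])
  then have "necklace_family G (2 * t) \<noteq> {}" using c G(2) by (metis not_le)
  then obtain S where "necklace (pverts G) (parcs G) (2 * t) S"
    unfolding necklace_family_empty_iff by metis
  from minor_triangle_path[OF pG this] obtain x :: "nat \<times> nat \<Rightarrow> 'a" where
    x: "inj_on x (triangle_index t)" "minor (triangle_path t x) G" by metis
  have "triangle_path t x \<in> F"
    using assms(2) G(1) pair_graph_triangle_path[OF x(1)] x(2) unfolding minor_closed_def by metis
  moreover define J where "J = {..<t} \<times> {2 :: nat} \<union> {(0, 0), (t - 1, 1)}"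
  have "minimal_blocking_set (triangle_path t x) (x ` J)"
    unfolding J_def by (rule minimal_blocking_set_triangle_path[OF x(1)]) (simp add: t_def)
  moreover have "b < card (x ` J)"
  proof -
    have J: "J \<subseteq> triangle_index t" by (auto simp: J_def triangle_index_def t_def)
    have "card ({..<t} \<times> {2 :: nat}) \<le> card J"
      by (rule card_mono[OF finite_subset[OF J finite_triangle_index]]) (auto simp: J_def)
    moreover have "card (x ` J) = card J" using inj_on_subset[OF x(1) J] by (rule card_image)
    ultimately show ?thesis by (simp add: t_def)
  qed
  ultimately show "\<exists>G\<in>F. \<exists>Y. minimal_blocking_set G Y \<and> card Y > b" by metis
qed

end
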